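(* Given a finite directed graph $G=(V,E)$ with $m$ edges and coBüchi objectives with target sets $T_i\subseteq V$ with $|T_i|=1$ for $1\le i\le k$, the winning set for the disjunction of the coBüchi objectives can be computed in $O(m)$ time.
   Context: A play is an infinite path in $G$; $\mathrm{Inf}(\omega)$ is the set of vertices occurring infinitely often in $\omega$. $\mathrm{coB\ddot{u}chi}(T)=\{\omega:\mathrm{Inf}(\omega)\cap T=\emptyset\}$. The winning set for the objective $\bigcup_{i=1}^k\mathrm{coB\ddot{u}chi}(T_i)$ is the set of vertices from which some infinite path belonging to this objective starts. *)

theory Defs
  imports Complex_Main "HOL-Library.Landau_Symbols" "HOL-Library.Omega_Words_Fun"
begin

section \<open>Plays, objectives and winning sets\<close>

definition digraph :: "'v set \<Rightarrow> ('v \<times> 'v) set \<Rightarrow> bool" where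
  "digraph V E \<longleftrightarrow> finite V \<and> E \<subseteq> V \<times> V"

definition plays :: "'v set \<Rightarrow> ('v \<times> 'v) set \<Rightarrow> (nat \<Rightarrow> 'v) set" where
  "plays V E = {\<omega>. \<forall>i. \<omega> i \<in> V \<and> (\<omega> i, \<omega> (Suc i)) \<in> E}"

text \<open>\<^const>\<open>limit\<close> is Inf: the set of letters occurring infinitely often.\<close>

definition coBuchi :: "'v set \<Rightarrow> (nat \<Rightarrow> 'v) set" where
  "coBuchi T = {\<omega>. limit \<omega> \<inter> T = {}}"

definition winning_set :: "'v set \<Rightarrow> ('v \<times> 'v) set \<Rightarrow> (nat \<Rightarrow> 'v) set \<Rightarrow> 'v set" where
  "winning_set V E Obj = {v \<in> V. \<exists>\<omega> \<in> plays V E. \<omega> 0 = v \<and> \<omega> \<in> Obj}"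

section \<open>A word RAM\<close>

text \<open>
  Random access machine programs in structured form: a program text mentions finitely many
  scalar registers and arrays, all holding natural numbers. Every operation costs one time unit.
  There is no multiplication, and every value computed has to be at most the word bound \<open>B\<close>:
  a program that overflows has no execution, so unit cost cannot be abused by packing
  a lot of data into one huge number. Subtraction is truncated.
\<close>

datatype exp =
    Const nat
  | Var nat
  | Get nat exp
  | Add exp exp
  | Sub exp exp

datatype cond =
    Less exp exp
  | Equal exp exp
  | Neg cond
  | Conj cond cond

datatype com =
    SKIP
  | Assign nat exp
  | Put nat exp exp
  | Seq com com
  | IF cond com com
  | WHILE cond com

record state =
  vars :: "nat \<Rightarrow> nat"
  arrs :: "nat \<Rightarrow> nat \<Rightarrow> nat"

fun eval :: "state \<Rightarrow> exp \<Rightarrow> nat" where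
  "eval s (Const c) = c"
| "eval s (Var x) = vars s x"
| "eval s (Get a e) = arrs s a (eval s e)"
| "eval s (Add e f) = eval s e + eval s f"
| "eval s (Sub e f) = eval s e - eval s f"

fun fits :: "nat \<Rightarrow> state \<Rightarrow> exp \<Rightarrow> bool" where
  "fits B s (Const c) \<longleftrightarrow> c \<le> B"
| "fits B s (Var x) \<longleftrightarrow> vars s x \<le> B"
| "fits B s (Get a e) \<longleftrightarrow> fits B s e \<and> arrs s a (eval s e) \<le> B"
| "fits B s (Add e f) \<longleftrightarrow> fits B s e \<and> fits B s f \<and> eval s e + eval s f \<le> B"
| "fits B s (Sub e f) \<longleftrightarrow> fits B s e \<and> fits B s f"

fun cost :: "exp \<Rightarrow> nat" where
  "cost (Const c) = 1"
| "cost (Var x) = 1"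
| "cost (Get a e) = 1 + cost e"
| "cost (Add e f) = 1 + cost e + cost f"
| "cost (Sub e f) = 1 + cost e + cost f"

fun holds :: "state \<Rightarrow> cond \<Rightarrow> bool" where
  "holds s (Less e f) \<longleftrightarrow> eval s e < eval s f"
| "holds s (Equal e f) \<longleftrightarrow> eval s e = eval s f"
| "holds s (Neg b) \<longleftrightarrow> \<not> holds s b"
| "holds s (Conj b c) \<longleftrightarrow> holds s b \<and> holds s c"

fun cfits :: "nat \<Rightarrow> state \<Rightarrow> cond \<Rightarrow> bool" where
  "cfits B s (Less e f) \<longleftrightarrow> fits B s e \<and> fits B s f"
| "cfits B s (Equal e f) \<longleftrightarrow> fits B s e \<and> fits B s f"
| "cfits B s (Neg b) \<longleftrightarrow> cfits B s b"
| "cfits B s (Conj b c) \<longleftrightarrow> cfits B s b \<and> cfits B s c"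

fun ccost :: "cond \<Rightarrow> nat" where
  "ccost (Less e f) = 1 + cost e + cost f"
| "ccost (Equal e f) = 1 + cost e + cost f"
| "ccost (Neg b) = 1 + ccost b"
| "ccost (Conj b c) = 1 + ccost b + ccost c"

text \<open>\<open>exec B p s t s'\<close>: with word bound \<open>B\<close>, the program \<open>p\<close> started in \<open>s\<close> halts in \<open>s'\<close>
  after exactly \<open>t\<close> time units.\<close>

inductive exec :: "nat \<Rightarrow> com \<Rightarrow> state \<Rightarrow> nat \<Rightarrow> state \<Rightarrow> bool" for B :: nat where
  Skip: "exec B SKIP s 1 s"
| Assign: "fits B s e \<Longrightarrow>
    exec B (Assign x e) s (1 + cost e) (s\<lparr>vars := (vars s)(x := eval s e)\<rparr>)"
| Put: "fits B s i \<Longrightarrow> fits B s e \<Longrightarrow>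
    exec B (Put a i e) s (1 + cost i + cost e)
      (s\<lparr>arrs := (arrs s)(a := (arrs s a)(eval s i := eval s e))\<rparr>)"
| Seq: "exec B p s t s' \<Longrightarrow> exec B q s' u s'' \<Longrightarrow> exec B (Seq p q) s (t + u) s''"
| IfTrue: "cfits B s b \<Longrightarrow> holds s b \<Longrightarrow> exec B p s t s' \<Longrightarrow>
    exec B (IF b p q) s (1 + ccost b + t) s'"
| IfFalse: "cfits B s b \<Longrightarrow> \<not> holds s b \<Longrightarrow> exec B q s t s' \<Longrightarrow>
    exec B (IF b p q) s (1 + ccost b + t) s'"
| WhileFalse: "cfits B s b \<Longrightarrow> \<not> holds s b \<Longrightarrow> exec B (WHILE b p) s (1 + ccost b) s"
| WhileTrue: "cfits B s b \<Longrightarrow> holds s b \<Longrightarrow> exec B p s t s' \<Longrightarrow> exec B (WHILE b p) s' u s'' \<Longrightarrow>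
    exec B (WHILE b p) s (1 + ccost b + t + u) s''"

inductive_cases SkipE: "exec B SKIP s t s'"
inductive_cases AssignE: "exec B (Assign x e) s t s'"
inductive_cases PutE: "exec B (Put a i e) s t s'"
inductive_cases SeqE: "exec B (Seq p q) s t s'"
inductive_cases IfE: "exec B (IF b p q) s t s'"
inductive_cases WhileE: "exec B (WHILE b p) s t s'"

lemma exec_deterministic:
  "exec B p s t s' \<Longrightarrow> exec B p s u s'' \<Longrightarrow> t = u \<and> s' = s''"
proof (induction arbitrary: u s'' rule: exec.induct)
  case (Skip s) then show ?case by (auto elim: SkipE)
next
  case (Assign s e x) from Assign.prems show ?case by (auto elim: AssignE)
next
  case (Put s i e a) from Put.prems show ?case by (auto elim: PutE)
next
  case (Seq p s t s' q v r)
  from Seq.prems obtain t1 s1 v1 where "u = t1 + v1" "exec B p s t1 s1" "exec B q s1 v1 s''"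
    by (rule SeqE)
  with Seq.IH(1)[of t1 s1] Seq.IH(2)[of v1 s''] show ?case by simp
next
  case (IfTrue s b p t s' q)
  from IfTrue.prems IfTrue.hyps obtain t1 where "u = 1 + ccost b + t1" "exec B p s t1 s''"
    by (auto elim: IfE)
  with IfTrue.IH[of t1 s''] show ?case by simp
next
  case (IfFalse s b q t s' p)
  from IfFalse.prems IfFalse.hyps obtain t1 where "u = 1 + ccost b + t1" "exec B q s t1 s''"
    by (auto elim: IfE)
  with IfFalse.IH[of t1 s''] show ?case by simp
next
  case (WhileFalse s b p)
  from WhileFalse.prems show ?case by (rule WhileE) (use WhileFalse.hyps in simp_all)
next
  case (WhileTrue s b p t s' v r)
  from WhileTrue.prems obtain t1 s1 v1 where
    "u = 1 + ccost b + t1 + v1" "exec B p s t1 s1" "exec B (WHILE b p) s1 v1 s''"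
    by (rule WhileE) (use WhileTrue.hyps in simp_all)
  with WhileTrue.IH(1)[of t1 s1] WhileTrue.IH(2)[of v1 s''] show ?case by simp
qed

section \<open>Input and output\<close>

text \<open>
  The graph on the vertices \<open>0, \<dots>, n - 1\<close> is given as a list of edges, in arrays 0 (sources)
  and 1 (heads); array 2 lists the target vertices. Registers 0, 1, 2 hold the number of vertices
  and the lengths of the two lists. All other memory is initially zero.
\<close>

definition input_state :: "nat \<Rightarrow> (nat \<times> nat) list \<Rightarrow> nat list \<Rightarrow> state" where
  "input_state n es ts =
    \<lparr>vars = (\<lambda>_. 0)(0 := n, 1 := length es, 2 := length ts),
     arrs = (\<lambda>_ _. 0)
       (0 := (\<lambda>i. if i < length es then fst (es ! i) else 0),
        1 := (\<lambda>i. if i < length es then snd (es ! i) else 0),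
        2 := (\<lambda>i. if i < length ts then ts ! i else 0))\<rparr>"

definition output_list :: "state \<Rightarrow> nat list" where
  "output_list s = map (arrs s 3) [0..<vars s 3]"

definition lists_set :: "'a list \<Rightarrow> 'a set \<Rightarrow> bool" where
  "lists_set xs A \<longleftrightarrow> distinct xs \<and> set xs = A"

end

theory Submission
  imports Defs
begin

text \<open>
  Fix one target \<open>r\<close> and forget its outgoing edges. Peeling off sinks repeatedly leaves exactly the
  set \<open>U\<close> of vertices that reach a cycle avoiding \<open>r\<close> without passing through \<open>r\<close>; they all win.
  The peeled part \<open>R\<close> is acyclic apart from the edges leaving \<open>r\<close>, so a play that stays in it returns
  to \<open>r\<close> again and again. Hence a peeled vertex wins iff it reaches \<open>r\<close> and \<open>r\<close> itself wins, and
  \<open>r\<close> wins iff it has a successor in \<open>U\<close> or lies on a cycle missing some target. The latter is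
  decided by a longest-path recursion along the peeling order: \<open>h u\<close> is the largest number of
  targets missed by a path from \<open>u\<close> to \<open>r\<close>, where \<open>r\<close> itself is counted as missed, and a cycle
  through \<open>r\<close> missing a target exists iff \<open>h w \<ge> 2\<close> for some successor \<open>w\<close> of \<open>r\<close>.

  The running time may depend neither on the number of vertices nor on the number of targets.
  Zero-initialised memory takes care of the former. For the latter, a play visits at most \<open>m\<close>
  vertices infinitely often, so \<open>m + 1\<close> distinct targets are as good as all of them.
\<close>

section \<open>Winning sets by peeling\<close>

lemma winning_set_trap:
  assumes "U \<subseteq> V" "\<And>u. u \<in> U \<Longrightarrow> \<exists>w\<in>U. (u, w) \<in> E" "t \<notin> U" "v \<in> U"
  shows "v \<in> winning_set V E (coBuchi {t})"
proof -
  obtain f where f: "\<And>u. u \<in> U \<Longrightarrow> f u \<in> U \<and> (u, f u) \<in> E" using assms(2) by metis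
  define \<omega> where "\<omega> = (\<lambda>i. (f ^^ i) v)"
  have U: "\<omega> i \<in> U" for i by (induction i) (auto simp: \<omega>_def assms(4) f)
  have "\<omega> \<in> plays V E"
    using U f assms(1) by (auto simp: plays_def \<omega>_def)
  moreover have "\<omega> \<in> coBuchi {t}"
    using U assms(3) by (auto simp: coBuchi_def limit_def INFM_nat)
  moreover have "\<omega> 0 = v" by (simp add: \<omega>_def)
  ultimately show ?thesis using assms(1,4) by (auto simp: winning_set_def)
qed

text \<open>Prefixing one vertex to a play leaves its set of recurrent vertices unchanged.\<close>

lemma winning_set_coBuchi_pred:
  assumes "(u, v) \<in> E" "u \<in> V" "v \<in> winning_set V E (coBuchi T)"
  shows "u \<in> winning_set V E (coBuchi T)"
proof -
  obtain \<omega> where \<omega>: "\<omega> \<in> plays V E" "\<omega> 0 = v" "limit \<omega> \<inter> T = {}"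
    using assms(3) by (auto simp: winning_set_def coBuchi_def)
  define \<omega>' where "\<omega>' = case_nat u \<omega>"
  have "\<omega>' \<in> plays V E"
    using \<omega> assms(1,2) by (auto simp: plays_def \<omega>'_def split: nat.split)
  moreover have "limit \<omega>' = limit \<omega>"
  proof -
    have "suffix 1 \<omega>' = \<omega>" by (auto simp: \<omega>'_def suffix_def)
    then show ?thesis by (metis limit_suffix)
  qed
  moreover have "\<omega>' 0 = u" by (simp add: \<omega>'_def)
  ultimately show ?thesis using \<omega>(3) assms(2) by (auto simp: winning_set_def coBuchi_def)
qed

text \<open>Each recurrent vertex is the source of an edge. This bound justifies cutting the target
  list down to \<open>m + 1\<close> entries.\<close>

lemma card_limit_play_le:
  assumes "\<omega> \<in> plays V E" "finite E"
  shows "finite (limit \<omega>)" "card (limit \<omega>) \<le> card E"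
proof -
  have sub: "limit \<omega> \<subseteq> fst ` E"
  proof
    fix a assume "a \<in> limit \<omega>"
    then obtain i where "\<omega> i = a" by (auto simp: limit_def INFM_nat)
    then have "(a, \<omega> (Suc i)) \<in> E" using assms(1) by (auto simp: plays_def)
    then show "a \<in> fst ` E" by force
  qed
  then show "finite (limit \<omega>)" using assms(2) finite_surj by blast
  show "card (limit \<omega>) \<le> card E"
    using sub assms(2) by (meson card_image_le card_mono finite_imageI le_trans)
qed

text \<open>A certificate for the winning set, separated from the algorithm that computes it.
  \<open>rank\<close> is a position in the peeling order. \<open>h_ge\<close> and
  \<open>h_attained\<close> express the recursion for \<open>h\<close> with truncated subtraction;
  for \<open>u\<close> in \<open>R\<close>, \<open>h u = 0\<close> means that \<open>r\<close>
  cannot be reached, so there is no edge to exhibit. \<open>cover\<close> speaks of sources of edges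
  because no play starts elsewhere.\<close>

locale peeling =
  fixes V :: "'v set" and E :: "('v \<times> 'v) set" and T :: "'v set" and r :: 'v
    and R U :: "'v set" and h rank :: "'v \<Rightarrow> nat"
  assumes edges: "E \<subseteq> V \<times> V" and finite_T: "finite T" and T_V: "T \<subseteq> V" and r_T: "r \<in> T"
    and r_R: "r \<in> R" and r_U: "r \<notin> U" and U_V: "U \<subseteq> V"
    and peeled: "\<lbrakk>(u, v) \<in> E; u \<in> R; u \<noteq> r\<rbrakk> \<Longrightarrow> v \<in> R \<and> rank v < rank u"
    and unpeeled: "u \<in> U \<Longrightarrow> \<exists>v\<in>U. (u, v) \<in> E"
    and cover: "(u, v) \<in> E \<Longrightarrow> u \<in> R \<or> u \<in> U"
    and h_root: "h r = card T"
    and h_ge: "\<lbrakk>(u, v) \<in> E; u \<in> R; u \<noteq> r\<rbrakk> \<Longrightarrow> h v - of_bool (u \<in> T) \<le> h u"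
    and h_attained: "\<lbrakk>u \<in> R; u \<noteq> r; 0 < h u\<rbrakk> \<Longrightarrow> \<exists>v. (u, v) \<in> E \<and> h u = h v - of_bool (u \<in> T)"
begin

text \<open>The threshold is 2 because \<open>h w\<close> already counts \<open>r\<close> as missed;
  a second missed target is missed by the whole cycle through \<open>r\<close> and
  \<open>w\<close>.\<close>

definition root_wins :: bool where
  "root_wins \<longleftrightarrow> (\<exists>w. (r, w) \<in> E \<and> (w \<in> U \<or> w \<in> R \<and> 2 \<le> h w))"

text \<open>Following the edges that attain \<open>h\<close> decreases \<open>rank\<close> and ends
  in \<open>r\<close>. The path is kept only as its vertex set \<open>p\<close>, which is all that a
  trap argument asks for.\<close>

lemma path_to_root:
  assumes "v \<in> R" "0 < h v"
  shows "\<exists>p\<subseteq>V. v \<in> p \<and> r \<in> p \<and> card (T \<inter> (p - {r})) + h v \<le> card T \<and>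
    (\<forall>u\<in>p - {r}. \<exists>w\<in>p. (u, w) \<in> E)"
  using assms
proof (induction "rank v" arbitrary: v rule: less_induct)
  case less
  show ?case
  proof (cases "v = r")
    case True
    then show ?thesis using T_V r_T h_root by (intro exI[of _ "{r}"]) auto
  next
    case False
    obtain w where w: "(v, w) \<in> E" "h v = h w - of_bool (v \<in> T)"
      using h_attained[OF less.prems(1) False less.prems(2)] by blast
    have "w \<in> R" "rank w < rank v" using peeled[OF w(1) less.prems(1) False] by auto
    moreover have "0 < h w" using w less.prems by auto
    ultimately obtain p where p: "p \<subseteq> V" "w \<in> p" "r \<in> p" "card (T \<inter> (p - {r})) + h w \<le> card T"
      "\<And>u. u \<in> p - {r} \<Longrightarrow> \<exists>w\<in>p. (u, w) \<in> E"
      using less.hyps[of w] by blast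
    have "T \<inter> (insert v p - {r}) = (if v \<in> T then insert v (T \<inter> (p - {r})) else T \<inter> (p - {r}))"
      using False by auto
    then have "card (T \<inter> (insert v p - {r})) \<le> card (T \<inter> (p - {r})) + of_bool (v \<in> T)"
      using finite_T by (auto simp: card_insert_if)
    \<comment> \<open>As \<open>0 < h v\<close>, the subtraction is not truncated: what
      \<open>v\<close> adds to the intersection is paid for by the drop from \<open>h w\<close> to
      \<open>h v\<close>.\<close>
    then have "card (T \<inter> (insert v p - {r})) + h v \<le> card T"
      using p(4) w(2) less.prems(2) by (auto split: if_splits)
    then show ?thesis using p w edges by (intro exI[of _ "insert v p"]) auto
  qed
qed

lemma root_wins_sound:
  assumes root_wins
  shows "\<exists>t\<in>T. r \<in> winning_set V E (coBuchi {t})"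
proof -
  obtain w where w: "(r, w) \<in> E" "w \<in> U \<or> w \<in> R \<and> 2 \<le> h w"
    using assms by (auto simp: root_wins_def)
  have "r \<in> V" using r_T T_V by auto
  show ?thesis
  proof (cases "w \<in> U")
    case True
    then have "w \<in> winning_set V E (coBuchi {r})"
      using U_V unpeeled r_U by (intro winning_set_trap[where U = U]) auto
    then show ?thesis using winning_set_coBuchi_pred[OF w(1) \<open>r \<in> V\<close>] r_T by blast
  next
    case False
    then have "w \<in> R" "2 \<le> h w" using w by auto
    then obtain p where p: "p \<subseteq> V" "w \<in> p" "r \<in> p" "card (T \<inter> (p - {r})) + h w \<le> card T"
      "\<And>u. u \<in> p - {r} \<Longrightarrow> \<exists>w\<in>p. (u, w) \<in> E"
      using path_to_root[of w] by auto
    have "T \<inter> p = insert r (T \<inter> (p - {r}))" using p(3) r_T by auto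
    then have "card (T \<inter> p) < card T"
      using p(4) \<open>2 \<le> h w\<close> finite_T by (simp add: card_insert_if)
    then obtain t where t: "t \<in> T" "t \<notin> p" by (metis Int_absorb2 less_irrefl subsetI)
    \<comment> \<open>The edge from \<open>r\<close> to \<open>w\<close> closes the path to a cycle,
      so \<open>p\<close> is a trap avoiding \<open>t\<close>.\<close>
    have "r \<in> winning_set V E (coBuchi {t})"
      using p t w by (intro winning_set_trap[where U = p]) auto
    then show ?thesis using t by blast
  qed
qed

text \<open>A play inside \<open>R\<close> descends in rank until it meets \<open>r\<close>, and on
  the way it visits at least the targets that \<open>h\<close> regards as unavoidable. The clause on
  ranks serves the induction: it shows that the start vertex does not recur.\<close>

lemma segment_to_root:
  assumes "\<omega> \<in> plays V E" "\<omega> i \<in> R"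
  shows "\<exists>j\<ge>i. \<omega> j = r \<and> r \<notin> \<omega> ` {i..<j} \<and> (\<forall>l\<in>{i..<j}. rank (\<omega> l) \<le> rank (\<omega> i)) \<and>
    card T \<le> h (\<omega> i) + card (T \<inter> \<omega> ` {i..<j})"
  using assms(2)
proof (induction "rank (\<omega> i)" arbitrary: i rule: less_induct)
  case less
  show ?case
  proof (cases "\<omega> i = r")
    case True
    then show ?thesis using h_root by (intro exI[of _ i]) auto
  next
    case False
    have e: "(\<omega> i, \<omega> (Suc i)) \<in> E" using assms(1) by (auto simp: plays_def)
    have d: "\<omega> (Suc i) \<in> R" "rank (\<omega> (Suc i)) < rank (\<omega> i)"
      using peeled[OF e less.prems False] by auto
    then obtain j where j: "Suc i \<le> j" "\<omega> j = r" "r \<notin> \<omega> ` {Suc i..<j}"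
      "\<forall>l\<in>{Suc i..<j}. rank (\<omega> l) \<le> rank (\<omega> (Suc i))"
      "card T \<le> h (\<omega> (Suc i)) + card (T \<inter> \<omega> ` {Suc i..<j})"
      using less.hyps[of "Suc i"] by blast
    have ins: "{i..<j} = insert i {Suc i..<j}" using j(1) by auto
    \<comment> \<open>All later vertices of the segment have smaller rank, so
      \<open>\<omega> i\<close> is new and is counted exactly once.\<close>
    have "\<omega> i \<notin> \<omega> ` {Suc i..<j}" using j(4) d(2) by (metis imageE leD)
    then have "card (T \<inter> \<omega> ` {i..<j}) = card (T \<inter> \<omega> ` {Suc i..<j}) + of_bool (\<omega> i \<in> T)"
      using finite_T by (auto simp: ins Int_insert_right)
    then have "card T \<le> h (\<omega> i) + card (T \<inter> \<omega> ` {i..<j})"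
      using j(5) h_ge[OF e less.prems False] by (auto split: if_splits)
    then show ?thesis using j False d by (intro exI[of _ j]) (auto simp: ins)
  qed
qed

text \<open>Winning is carried backwards from \<open>r\<close> along the edges that attain
  \<open>h\<close>.\<close>

lemma peeled_sound:
  assumes "root_wins" "v \<in> R" "0 < h v"
  shows "\<exists>t\<in>T. v \<in> winning_set V E (coBuchi {t})"
  using assms(2,3)
proof (induction "rank v" arbitrary: v rule: less_induct)
  case less
  show ?case
  proof (cases "v = r")
    case True
    then show ?thesis using root_wins_sound[OF assms(1)] by simp
  next
    case False
    obtain w where w: "(v, w) \<in> E" "h v = h w - of_bool (v \<in> T)"
      using h_attained[OF less.prems(1) False less.prems(2)] by blast
    then obtain t where "t \<in> T" "w \<in> winning_set V E (coBuchi {t})"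
      using less.hyps[of w] peeled[OF w(1) less.prems(1) False] less.prems by auto
    then show ?thesis using winning_set_coBuchi_pred[OF w(1)] w(1) edges by blast
  qed
qed

text \<open>The segment up to the first visit of \<open>r\<close> omits the target \<open>r\<close>,
  hence \<open>0 < h (\<omega> 0)\<close>. If \<open>root_wins\<close> failed, the play would return
  to \<open>r\<close> forever; a round trip after the last visit of \<open>t\<close> avoids
  \<open>t\<close> between two visits of \<open>r\<close> and so forces \<open>h\<close> to be at
  least 2 at a successor of \<open>r\<close>.\<close>

lemma peeled_complete:
  assumes \<omega>: "\<omega> \<in> plays V E" "\<omega> 0 \<in> R" "t \<in> T" "t \<notin> limit \<omega>"
  shows "0 < h (\<omega> 0)" "root_wins"
proof -
  have e: "(\<omega> i, \<omega> (Suc i)) \<in> E" for i using \<omega>(1) by (auto simp: plays_def)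
  obtain j0 where j0: "\<omega> j0 = r" "r \<notin> \<omega> ` {0..<j0}" "card T \<le> h (\<omega> 0) + card (T \<inter> \<omega> ` {0..<j0})"
    using segment_to_root[OF \<omega>(1,2)] by auto
  have "card (T \<inter> \<omega> ` {0..<j0}) < card T"
    using j0(2) r_T finite_T by (intro psubset_card_mono) auto
  then show "0 < h (\<omega> 0)" using j0(3) by simp
  show root_wins
  proof (rule ccontr)
    assume nw: "\<not> root_wins"
    \<comment> \<open>The successor has itself an outgoing edge, so \<open>cover\<close> applies,
      and \<open>U\<close> is excluded by \<open>nw\<close>.\<close>
    have succ: "\<omega> (Suc j) \<in> R" if "\<omega> j = r" for j
      using nw e[of j] cover[OF e[of "Suc j"]] that by (auto simp: root_wins_def)
    have inf: "\<exists>j\<ge>k. \<omega> j = r" for k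
    proof (induction k)
      case 0
      then show ?case using j0 by auto
    next
      case (Suc k)
      then obtain j where "j \<ge> k" "\<omega> j = r" by auto
      then show ?case using segment_to_root[OF \<omega>(1) succ, of j] by (auto dest: le_trans)
    qed
    then have "r \<in> limit \<omega>" by (auto simp: limit_def INFM_nat_le)
    then have "t \<noteq> r" using \<omega>(4) by auto
    obtain k where k: "\<And>i. k \<le> i \<Longrightarrow> \<omega> i \<noteq> t"
      using \<omega>(4) by (auto simp: limit_def INFM_nat_le)
    obtain j where j: "k \<le> j" "\<omega> j = r" using inf by auto
    obtain l where l: "r \<notin> \<omega> ` {Suc j..<l}"
      "card T \<le> h (\<omega> (Suc j)) + card (T \<inter> \<omega> ` {Suc j..<l})"
      using segment_to_root[OF \<omega>(1) succ[OF j(2)]] by auto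
    \<comment> \<open>From \<open>k\<close> on \<open>t\<close> does not occur, and the segment
      stops just before \<open>r\<close>.\<close>
    have "card (T \<inter> \<omega> ` {Suc j..<l}) \<le> card (T - {t, r})"
      using l(1) k j(1) finite_T by (intro card_mono) (auto, metis le_SucI le_trans)
    also have "card (T - {t, r}) = card T - 2"
      using \<open>t \<noteq> r\<close> \<omega>(3) r_T finite_T by (simp add: card_Diff_subset)
    finally have "card (T \<inter> \<omega> ` {Suc j..<l}) \<le> card T - 2" .
    moreover have "2 \<le> card T"
      using \<open>t \<noteq> r\<close> \<omega>(3) r_T finite_T card_mono[of T "{t, r}"] by simp
    ultimately have "2 \<le> h (\<omega> (Suc j))" using l(2) by linarith
    then show False using nw e[of j] j(2) succ[OF j(2)] by (auto simp: root_wins_def)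
  qed
qed

theorem winning_set_eq:
  "winning_set V E (\<Union>t\<in>T. coBuchi {t}) = U \<union> {u \<in> R. root_wins \<and> 0 < h u}"
proof -
  have *: "winning_set V E (\<Union>t\<in>T. coBuchi {t}) = (\<Union>t\<in>T. winning_set V E (coBuchi {t}))"
    by (auto simp: winning_set_def)
  show ?thesis unfolding *
  proof (intro equalityI subsetI)
    fix v assume "v \<in> (\<Union>t\<in>T. winning_set V E (coBuchi {t}))"
    then obtain t \<omega> where \<omega>: "t \<in> T" "\<omega> \<in> plays V E" "\<omega> 0 = v" "t \<notin> limit \<omega>"
      by (auto simp: winning_set_def coBuchi_def)
    have "(v, \<omega> 1) \<in> E" using \<omega> by (auto simp: plays_def)
    from cover[OF this] show "v \<in> U \<union> {u \<in> R. root_wins \<and> 0 < h u}"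
      using peeled_complete[OF \<omega>(2) _ \<omega>(1,4)] \<omega>(3) by auto
  next
    fix v assume "v \<in> U \<union> {u \<in> R. root_wins \<and> 0 < h u}"
    then consider "v \<in> U" | "v \<in> R" "root_wins" "0 < h v" by auto
    then show "v \<in> (\<Union>t\<in>T. winning_set V E (coBuchi {t}))"
    proof cases
      case 1
      then have "v \<in> winning_set V E (coBuchi {r})"
        using U_V unpeeled r_U by (intro winning_set_trap[where U = U]) auto
      then show ?thesis using r_T by auto
    next
      case 2
      then show ?thesis using peeled_sound by auto
    qed
  qed
qed

end

section \<open>Symbolic execution and running time\<close>

text \<open>\<open>run\<close>, \<open>run_fits\<close> and \<open>run_time\<close> are meant for loop-free programs; on \<open>WHILE\<close> they return
  junk, which is harmless because \<open>run_fits\<close> is false there.\<close>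

fun run :: "com \<Rightarrow> state \<Rightarrow> state" where
  "run SKIP s = s"
| "run (Assign x e) s = s\<lparr>vars := (vars s)(x := eval s e)\<rparr>"
| "run (Put a i e) s = s\<lparr>arrs := (arrs s)(a := (arrs s a)(eval s i := eval s e))\<rparr>"
| "run (Seq p q) s = run q (run p s)"
| "run (IF b p q) s = (if holds s b then run p s else run q s)"
| "run (WHILE b p) s = s"

fun run_fits :: "nat \<Rightarrow> com \<Rightarrow> state \<Rightarrow> bool" where
  "run_fits B SKIP s \<longleftrightarrow> True"
| "run_fits B (Assign x e) s \<longleftrightarrow> fits B s e"
| "run_fits B (Put a i e) s \<longleftrightarrow> fits B s i \<and> fits B s e"
| "run_fits B (Seq p q) s \<longleftrightarrow> run_fits B p s \<and> run_fits B q (run p s)"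
| "run_fits B (IF b p q) s \<longleftrightarrow> cfits B s b \<and> (if holds s b then run_fits B p s else run_fits B q s)"
| "run_fits B (WHILE b p) s \<longleftrightarrow> False"

fun run_time :: "com \<Rightarrow> nat" where
  "run_time SKIP = 1"
| "run_time (Assign x e) = 1 + cost e"
| "run_time (Put a i e) = 1 + cost i + cost e"
| "run_time (Seq p q) = run_time p + run_time q"
| "run_time (IF b p q) = 1 + ccost b + run_time p + run_time q"
| "run_time (WHILE b p) = 0"

text \<open>The time is only bounded: \<open>run_time\<close> adds both branches of a conditional
  and is thereby independent of the state.\<close>

lemma exec_run: "run_fits B p s \<Longrightarrow> \<exists>t\<le>run_time p. exec B p s t (run p s)"
proof (induction p arbitrary: s)
  case (Seq p q)
  then obtain t u where "t \<le> run_time p" "exec B p s t (run p s)"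
    "u \<le> run_time q" "exec B q (run p s) u (run q (run p s))" by fastforce
  then show ?case by (auto intro!: exI[of _ "t + u"] exec.Seq)
next
  case (IF b p q)
  show ?case
  proof (cases "holds s b")
    case True
    then obtain t where "t \<le> run_time p" "exec B p s t (run p s)" using IF by fastforce
    then show ?thesis using True IF.prems
      by (auto intro!: exI[of _ "1 + ccost b + t"] exec.IfTrue simp del: add_Suc)
  next
    case False
    then obtain t where "t \<le> run_time q" "exec B q s t (run q s)" using IF by fastforce
    then show ?thesis using False IF.prems
      by (auto intro!: exI[of _ "1 + ccost b + t"] exec.IfFalse simp del: add_Suc)
  qed
next
  case SKIP
  then show ?case using exec.Skip[of B s] by auto
next
  case (Assign x e)
  then show ?case using exec.Assign[of B s e x] by auto
next
  case (Put a i e)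
  then show ?case using exec.Put[of B s i e a] by auto
qed simp

text \<open>Total correctness with a time budget; the existence of an execution includes the absence
  of overflow.\<close>

definition runs :: "nat \<Rightarrow> com \<Rightarrow> state \<Rightarrow> nat \<Rightarrow> (state \<Rightarrow> bool) \<Rightarrow> bool" where
  "runs B p s c Q \<longleftrightarrow> (\<exists>t s'. exec B p s t s' \<and> t \<le> c \<and> Q s')"

lemma runs_straight: "run_fits B p s \<Longrightarrow> Q (run p s) \<Longrightarrow> runs B p s (run_time p) Q"
  unfolding runs_def using exec_run by blast

lemma runs_Seq:
  assumes "runs B p s c Q" "\<And>s'. Q s' \<Longrightarrow> runs B q s' c' Q'"
  shows "runs B (Seq p q) s (c + c') Q'"
  using assms unfolding runs_def by (meson add_mono exec.Seq)

text \<open>The measure allows at most \<open>M\<close> iterations of the loop-free body; the extra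
  summand in \<open>M + 1\<close> pays for the final, failing test.\<close>

lemma runs_While:
  fixes \<mu> :: "state \<Rightarrow> nat"
  assumes "I s" "\<mu> s \<le> M"
    and "\<And>s. I s \<Longrightarrow> cfits B s b"
    and "\<And>s. I s \<Longrightarrow> holds s b \<Longrightarrow> run_fits B p s \<and> I (run p s) \<and> \<mu> (run p s) < \<mu> s"
  shows "runs B (WHILE b p) s ((M + 1) * (1 + ccost b + run_time p)) (\<lambda>s. I s \<and> \<not> holds s b)"
  using assms(1,2)
proof (induction M arbitrary: s rule: less_induct)
  case (less M)
  show ?case
  proof (cases "holds s b")
    case False
    then have "exec B (WHILE b p) s (1 + ccost b) s"
      using less.prems assms(3) by (intro exec.WhileFalse)
    then show ?thesis unfolding runs_def using less.prems False
      by (intro exI[of _ "1 + ccost b"] exI[of _ s]) auto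
  next
    case True
    have step: "run_fits B p s" "I (run p s)" "\<mu> (run p s) < \<mu> s" using assms(4)[OF less.prems(1) True] by auto
    obtain t where t: "t \<le> run_time p" "exec B p s t (run p s)" using exec_run[OF step(1)] by blast
    obtain M' where M: "M = Suc M'" using step(3) less.prems(2) by (cases M) auto
    have "\<mu> (run p s) \<le> M'" using step(3) less.prems(2) M by simp
    then obtain u s'' where u: "exec B (WHILE b p) (run p s) u s''"
      "u \<le> (M' + 1) * (1 + ccost b + run_time p)" "I s''" "\<not> holds s'' b"
      using less.IH[of M' "run p s"] step(2) M unfolding runs_def by auto
    have "exec B (WHILE b p) s (1 + ccost b + t + u) s''"
      using exec.WhileTrue[OF assms(3)[OF less.prems(1)] True t(2) u(1)] .
    moreover have "1 + ccost b + t + u \<le> (M + 1) * (1 + ccost b + run_time p)"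
      using t(1) u(2) M by (simp add: algebra_simps)
    ultimately show ?thesis using u unfolding runs_def by blast
  qed
qed

lemma runs_weaken: "runs B p s c Q \<Longrightarrow> c \<le> c' \<Longrightarrow> (\<And>s. Q s \<Longrightarrow> Q' s) \<Longrightarrow> runs B p s c' Q'"
  unfolding runs_def by (meson order_trans)

section \<open>The program\<close>

text \<open>
  The pointers \<open>a_head\<close>, \<open>a_next\<close>, \<open>r_cur\<close> form linked lists of incoming edges; edge \<open>j\<close> is
  represented by \<open>j + 1\<close>, and \<open>0\<close> ends a list.
\<close>

abbreviation (input) r_m :: nat where "r_m \<equiv> 1"
abbreviation (input) r_len :: nat where "r_len \<equiv> 2"
abbreviation (input) r_out :: nat where "r_out \<equiv> 3"
abbreviation (input) r_j :: nat where "r_j \<equiv> 4"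
abbreviation (input) r_K :: nat where "r_K \<equiv> 5"
abbreviation (input) r_root :: nat where "r_root \<equiv> 6"
abbreviation (input) r_qi :: nat where "r_qi \<equiv> 7"
abbreviation (input) r_qn :: nat where "r_qn \<equiv> 8"
abbreviation (input) r_cur :: nat where "r_cur \<equiv> 9"
abbreviation (input) r_b :: nat where "r_b \<equiv> 10"
abbreviation (input) r_u :: nat where "r_u \<equiv> 11"
abbreviation (input) r_v :: nat where "r_v \<equiv> 12"

abbreviation (input) a_src :: nat where "a_src \<equiv> 0"
abbreviation (input) a_dst :: nat where "a_dst \<equiv> 1"
abbreviation (input) a_ts :: nat where "a_ts \<equiv> 2"
abbreviation (input) a_out :: nat where "a_out \<equiv> 3"
abbreviation (input) a_tgt :: nat where "a_tgt \<equiv> 4"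
abbreviation (input) a_deg :: nat where "a_deg \<equiv> 5"
abbreviation (input) a_head :: nat where "a_head \<equiv> 6"
abbreviation (input) a_next :: nat where "a_next \<equiv> 7"
abbreviation (input) a_queue :: nat where "a_queue \<equiv> 8"
abbreviation (input) a_inq :: nat where "a_inq \<equiv> 9"
abbreviation (input) a_h :: nat where "a_h \<equiv> 10"
abbreviation (input) a_done :: nat where "a_done \<equiv> 11"

definition incr :: "nat \<Rightarrow> com" where
  "incr x = Assign x (Add (Var x) (Const 1))"

definition mark_body :: com where
  "mark_body = Seq (Put a_tgt (Get a_ts (Var r_j)) (Const 1)) (incr r_j)"

text \<open>Skipping the edges out of the root is how they are forgotten: neither the degrees nor
  the lists see them.\<close>

definition link_body :: com where
  "link_body = Seq
    (Seq (Assign r_u (Get a_src (Var r_j))) (Assign r_v (Get a_dst (Var r_j))))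
    (Seq
      (IF (Equal (Var r_u) (Var r_root)) SKIP
        (Seq (Put a_deg (Var r_u) (Add (Get a_deg (Var r_u)) (Const 1)))
          (Seq (Put a_next (Add (Var r_j) (Const 1)) (Get a_head (Var r_v)))
            (Put a_head (Var r_v) (Add (Var r_j) (Const 1))))))
      (incr r_j))"

definition enqueue :: "nat \<Rightarrow> com" where
  "enqueue x = Seq (Put a_queue (Var r_qn) (Var x)) (incr r_qn)"

text \<open>Initial sinks are sought among heads of edges rather than among all vertices, so that
  the time does not depend on \<open>n\<close>.\<close>

definition sink_body :: com where
  "sink_body = Seq
    (Assign r_v (Get a_dst (Var r_j)))
    (Seq
      (IF (Conj (Equal (Get a_deg (Var r_v)) (Const 0)) (Equal (Get a_inq (Var r_v)) (Const 0)))
        (Seq (enqueue r_v) (Put a_inq (Var r_v) (Const 1)))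
        SKIP)
      (incr r_j))"

text \<open>A single loop runs over both the queue and the incoming edges of the current vertex, so its
  iterations are counted by one potential. Since \<open>r_qi \<le> r_qn\<close>, the loop condition
  \<open>r_qi < r_qn + r_cur\<close> says that the queue is nonempty or \<open>r_cur \<noteq> 0\<close>.\<close>

definition peel_body :: com where
  "peel_body =
    IF (Equal (Var r_cur) (Const 0))
      (Seq (Assign r_cur (Get a_head (Get a_queue (Var r_qi)))) (incr r_qi))
      (Seq
        (Seq (Assign r_u (Get a_src (Sub (Var r_cur) (Const 1))))
          (Assign r_v (Get a_dst (Sub (Var r_cur) (Const 1)))))
        (Seq
          (Seq (Put a_deg (Var r_u) (Sub (Get a_deg (Var r_u)) (Const 1)))
            (IF (Less (Get a_h (Var r_u)) (Get a_h (Var r_v)))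
              (Put a_h (Var r_u) (Get a_h (Var r_v))) SKIP))
          (Seq
            (IF (Equal (Get a_deg (Var r_u)) (Const 0))
              (Seq (Put a_h (Var r_u) (Sub (Get a_h (Var r_u)) (Get a_tgt (Var r_u))))
                (enqueue r_u))
              SKIP)
            (Assign r_cur (Get a_next (Var r_cur))))))"

text \<open>The condition language lacks disjunction. By De Morgan, the test asks whether the head
  is unpeeled or has \<open>h\<close> at least 2.\<close>

definition root_body :: com where
  "root_body = Seq
    (Assign r_v (Get a_dst (Var r_j)))
    (Seq
      (IF (Conj (Equal (Get a_src (Var r_j)) (Var r_root))
          (Neg (Conj (Equal (Get a_deg (Var r_v)) (Const 0)) (Less (Get a_h (Var r_v)) (Const 2)))))
        (Assign r_b (Const 1)) SKIP)
      (incr r_j))"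

text \<open>Only sources of edges can win, so scanning them suffices; \<open>a_done\<close> prevents
  listing a vertex twice.\<close>

definition output_body :: com where
  "output_body = Seq
    (Assign r_u (Get a_src (Var r_j)))
    (Seq
      (IF (Conj (Equal (Get a_done (Var r_u)) (Const 0))
          (Neg (Conj (Equal (Get a_deg (Var r_u)) (Const 0))
            (Neg (Conj (Equal (Var r_b) (Const 1)) (Less (Const 0) (Get a_h (Var r_u))))))))
        (Seq (Seq (Put a_out (Var r_out) (Var r_u)) (incr r_out)) (Put a_done (Var r_u) (Const 1)))
        SKIP)
      (incr r_j))"

text \<open>\<open>r_K\<close> becomes the minimum of the number of targets and
  \<open>m + 1\<close>.\<close>

definition init_targets :: com where
  "init_targets = Seq
    (IF (Less (Var r_m) (Var r_len)) (Assign r_K (Add (Var r_m) (Const 1)))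
      (Assign r_K (Var r_len)))
    (Assign r_j (Const 0))"

definition init_link :: com where
  "init_link = Seq (Assign r_root (Get a_ts (Const 0))) (Assign r_j (Const 0))"

text \<open>Without its outgoing edges the root is the first sink, and its trivial path misses all
  \<open>K\<close> targets, itself included.\<close>

definition init_sinks :: com where
  "init_sinks = Seq (Seq (Assign r_qn (Const 0)) (enqueue r_root))
    (Seq (Seq (Put a_inq (Var r_root) (Const 1)) (Put a_h (Var r_root) (Var r_K)))
      (Assign r_j (Const 0)))"

definition init_peel :: com where
  "init_peel = Seq (Assign r_qi (Const 0)) (Assign r_cur (Const 0))"

definition init_root :: com where
  "init_root = Seq (Assign r_b (Const 0)) (Assign r_j (Const 0))"

definition init_output :: com where
  "init_output = Seq (Assign r_out (Const 0)) (Assign r_j (Const 0))"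

definition for_edges :: "com \<Rightarrow> com" where
  "for_edges p = WHILE (Less (Var r_j) (Var r_m)) p"

definition solve :: com where
  "solve =
    Seq init_targets (Seq (WHILE (Less (Var r_j) (Var r_K)) mark_body)
    (Seq init_link (Seq (for_edges link_body)
    (Seq init_sinks (Seq (for_edges sink_body)
    (Seq init_peel (Seq (WHILE (Less (Var r_qi) (Add (Var r_qn) (Var r_cur))) peel_body)
    (Seq init_root (Seq (for_edges root_body)
    (Seq init_output (for_edges output_body)))))))))))"

text \<open>\<open>solve\<close> takes its root from the target list. If that list is empty, so are
  the objective and the initial output.\<close>

definition coBuchi_program :: com where
  "coBuchi_program = IF (Equal (Var r_len) (Const 0)) SKIP solve"

lemmas code_defs = incr_def mark_body_def link_body_def enqueue_def sink_body_def peel_body_def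
  root_body_def output_body_def init_targets_def init_link_def init_sinks_def init_peel_def
  init_root_def init_output_def

section \<open>Arrays read as lists, under appending\<close>

lemma inj_on_snoc: "inj_on q {..<l} \<Longrightarrow> x \<notin> q ` {..<l} \<Longrightarrow> inj_on (q(l := x)) {..<Suc l}"
  by (auto simp: inj_on_def less_Suc_eq)

lemma image_snoc: "(q(l := x)) ` {..<Suc l} = insert x (q ` {..<l})"
  by (auto simp: lessThan_Suc)

lemma Collect_image_snoc:
  "{u \<in> f ` {..<Suc l}. P u} =
    (if P (f l) then insert (f l) {u \<in> f ` {..<l}. P u} else {u \<in> f ` {..<l}. P u})"
  by (auto simp: lessThan_Suc)

lemma flag_snoc: "(\<lambda>v. of_bool (v \<in> A))(x := Suc 0) = (\<lambda>v. of_bool (v \<in> insert x A))"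
  by auto

section \<open>Correctness of the peeling loop\<close>

locale coBuchi_input =
  fixes n :: nat and es :: "(nat \<times> nat) list" and ts :: "nat list"
  assumes es_n: "set es \<subseteq> {..<n} \<times> {..<n}" and distinct_ts: "distinct ts"
    and ts_n: "set ts \<subseteq> {..<n}" and ts_nonempty: "ts \<noteq> []"
begin

definition m :: nat where "m = length es"
text \<open>The default 0 agrees with the initial memory, so the array equals this function
  everywhere.\<close>

definition src :: "nat \<Rightarrow> nat" where "src j = (if j < m then fst (es ! j) else 0)"
definition dst :: "nat \<Rightarrow> nat" where "dst j = (if j < m then snd (es ! j) else 0)"
definition tgt :: "nat \<Rightarrow> nat" where "tgt j = (if j < length ts then ts ! j else 0)"
definition root :: nat where "root = ts ! 0"
definition K :: nat where "K = min (length ts) (m + 1)"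
definition T :: "nat set" where "T = set (take K ts)"
text \<open>Room for vertices, counters and the sum \<open>r_qn + r_cur\<close> of the peeling loop,
  which is at most \<open>3 * m + 1\<close>.\<close>

definition B :: nat where "B = 6 * (n + m + 1)"
text \<open>All other vertices are isolated; the queue contains touched vertices only.\<close>

definition touched :: "nat set" where "touched = insert root (src ` {..<m} \<union> dst ` {..<m})"

section \<open>Size bounds for the instance\<close>

lemma src_less: "j < m \<Longrightarrow> src j < n" and dst_less: "j < m \<Longrightarrow> dst j < n"
  using subsetD[OF es_n nth_mem, of j] by (auto simp: src_def dst_def m_def mem_Times_iff)

lemma set_es: "set es = (\<lambda>j. (src j, dst j)) ` {..<m}"
proof -
  have "set es = (!) es ` {..<m}" by (auto simp: set_conv_nth m_def)
  also have "\<dots> = (\<lambda>j. (src j, dst j)) ` {..<m}" by (rule image_cong) (auto simp: src_def dst_def)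
  finally show ?thesis .
qed

lemma K_pos: "0 < K" using ts_nonempty by (simp add: K_def)
lemma K_le: "K \<le> m + 1" "K \<le> length ts" by (auto simp: K_def)

lemma card_T: "card T = K"
  using K_le distinct_ts by (simp add: T_def distinct_card)

lemma tgt_less: "j < K \<Longrightarrow> tgt j < n"
  using K_le(2) subsetD[OF ts_n nth_mem, of j] by (simp add: tgt_def)

lemma root_T: "root \<in> T"
  using K_pos ts_nonempty by (auto simp: root_def T_def in_set_conv_nth K_le)

lemma T_n: "T \<subseteq> {..<n}"
  using ts_n set_take_subset[of K ts] by (auto simp: T_def)

lemma root_less: "root < n" using root_T T_n by auto

lemma length_ts: "length ts \<le> n"
  using card_mono[OF _ ts_n] distinct_card[OF distinct_ts] by simp

lemma finite_touched: "finite touched" by (simp add: touched_def)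

lemma card_touched: "card touched \<le> 2 * m + 1"
proof -
  have "card (src ` {..<m} \<union> dst ` {..<m}) \<le> m + m"
    by (rule order_trans[OF card_Un_le add_mono]) (use card_image_le[of "{..<m}"] in auto)
  then show ?thesis unfolding touched_def
    using card_insert_le_m1[of "2 * m + 1"] by (simp add: card_insert_if)
qed

lemma touched_less: "u \<in> touched \<Longrightarrow> u < n"
  using src_less dst_less root_less by (auto simp: touched_def)

text \<open>The contents of the linked lists: since edges are inserted in order, a list is determined by its
  first element, which is the largest one.\<close>

primrec last_in :: "nat \<Rightarrow> nat \<Rightarrow> nat" where
  "last_in v 0 = 0"
| "last_in v (Suc j) = (if src j \<noteq> root \<and> dst j = v then Suc j else last_in v j)"

lemma last_in_le: "last_in v i \<le> i"
  by (induction i) auto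

lemma last_in_edge:
  "last_in v i \<noteq> 0 \<Longrightarrow> src (last_in v i - 1) \<noteq> root \<and> dst (last_in v i - 1) = v"
  by (induction i) (auto split: if_splits)

text \<open>Strict because edge \<open>j\<close> is represented by the pointer
  \<open>j + 1\<close>.\<close>

lemma less_last_in: "j < i \<Longrightarrow> src j \<noteq> root \<Longrightarrow> j < last_in (dst j) i"
  by (induction i) (auto simp: less_Suc_eq)

text \<open>An edge is done once its head has been dequeued, except that for the vertex dequeued
  last (\<open>Suc i = qi\<close>) only indices from \<open>cur\<close> on are done: lists run
  downwards, and the pointer \<open>cur\<close> stands for edge \<open>cur - 1\<close>, the next one
  to be read.\<close>

definition pending :: "nat \<Rightarrow> nat \<Rightarrow> (nat \<Rightarrow> nat) \<Rightarrow> nat set" where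
  "pending cur qi q = {j. j < m \<and> src j \<noteq> root \<and> \<not> (\<exists>i<qi. q i = dst j \<and> (Suc i = qi \<longrightarrow> cur \<le> j))}"

definition processed :: "nat \<Rightarrow> nat \<Rightarrow> (nat \<Rightarrow> nat) \<Rightarrow> nat set" where
  "processed cur qi q = {j. j < m \<and> src j \<noteq> root \<and> (\<exists>i<qi. q i = dst j \<and> (Suc i = qi \<longrightarrow> cur \<le> j))}"

text \<open>While \<open>u\<close> is unpeeled, \<open>h u\<close> is the maximum over the successors seen so far; \<open>u\<close> itself is
  charged only when it is peeled.\<close>

definition charge :: "(nat \<Rightarrow> nat) \<Rightarrow> nat \<Rightarrow> nat" where
  "charge deg u = of_bool (deg u = 0 \<and> u \<in> T)"

text \<open>Dequeued entries stay in \<open>q\<close>, so it lists the whole peeled set in order.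
  The clause placing heads of processed edges before their sources later yields \<open>rank\<close>;
  the clauses on \<open>h\<close> are the recursion restricted to processed edges.\<close>

definition peel_inv ::
  "nat \<Rightarrow> nat \<Rightarrow> nat \<Rightarrow> (nat \<Rightarrow> nat) \<Rightarrow> (nat \<Rightarrow> nat) \<Rightarrow> (nat \<Rightarrow> nat) \<Rightarrow> bool" where
  "peel_inv cur qi qn q deg h \<longleftrightarrow>
    qi \<le> qn \<and>
    (cur \<noteq> 0 \<longrightarrow> qi \<noteq> 0 \<and> cur \<le> m \<and> src (cur - 1) \<noteq> root \<and> dst (cur - 1) = q (qi - 1)) \<and>
    inj_on q {..<qn} \<and>
    q ` {..<qn} = {u \<in> touched. deg u = 0} \<and>
    (\<forall>u. deg u = card {j \<in> pending cur qi q. src j = u}) \<and>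
    (\<forall>j\<in>processed cur qi q. \<forall>a<qn. \<forall>b<qn. q a = src j \<and> q b = dst j \<longrightarrow> b < a) \<and>
    h root = K \<and> (\<forall>u. h u \<le> K) \<and>
    (\<forall>j\<in>processed cur qi q. h (dst j) - charge deg (src j) \<le> h (src j)) \<and>
    (\<forall>u. u \<noteq> root \<and> 0 < h u \<longrightarrow>
      (\<exists>j\<in>processed cur qi q. src j = u \<and> h u = h (dst j) - charge deg u))"

section \<open>Bounds implied by the peeling invariant\<close>

lemma pending_subset: "pending cur qi q \<subseteq> {..<m}" by (auto simp: pending_def)
lemma finite_pending: "finite (pending cur qi q)" by (rule finite_subset[OF pending_subset]) simp

lemma peel_inv_length:
  assumes "peel_inv cur qi qn q deg h"
  shows "qn \<le> 2 * m + 1"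
proof -
  have q: "inj_on q {..<qn}" "q ` {..<qn} = {u \<in> touched. deg u = 0}"
    using assms by (simp_all only: peel_inv_def)
  have "qn = card (q ` {..<qn})" using card_image[OF q(1)] by simp
  also have "\<dots> \<le> card touched" unfolding q(2) using finite_touched by (intro card_mono) auto
  finally show ?thesis using card_touched by simp
qed

lemma peel_inv_deg:
  assumes "peel_inv cur qi qn q deg h"
  shows "deg u \<le> m"
proof -
  have "deg u = card {j \<in> pending cur qi q. src j = u}" using assms by (simp add: peel_inv_def)
  also have "\<dots> \<le> card {..<m}" using pending_subset by (intro card_mono) auto
  finally show ?thesis by simp
qed

lemma peel_inv_bounds:
  assumes "peel_inv cur qi qn q deg h"
  shows "qi \<le> qn" "cur \<le> m" "h u \<le> K"
  using assms unfolding peel_inv_def by (cases "cur = 0"; simp)+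

text \<open>Dequeuing changes neither set of edges: the previous list is exhausted, and all edges of
  the new one lie below its first pointer.\<close>

lemma peel_next_vertex:
  assumes inv: "peel_inv 0 qi qn q deg h" and "qi < qn"
  shows "peel_inv (last_in (q qi) m) (Suc qi) qn q deg h"
    and "pending (last_in (q qi) m) (Suc qi) q = pending 0 qi q"
proof -
  have *: "(\<exists>i<Suc qi. q i = dst j \<and> (Suc i = Suc qi \<longrightarrow> last_in (q qi) m \<le> j)) \<longleftrightarrow>
      (\<exists>i<qi. q i = dst j \<and> (Suc i = qi \<longrightarrow> 0 \<le> j))" if "j < m" "src j \<noteq> root" for j
    using less_last_in[OF that] by (auto simp: less_Suc_eq)
  show pend: "pending (last_in (q qi) m) (Suc qi) q = pending 0 qi q"
    unfolding pending_def using * by auto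
  have proc: "processed (last_in (q qi) m) (Suc qi) q = processed 0 qi q"
    unfolding processed_def using * by auto
  have "last_in (q qi) m \<noteq> 0 \<longrightarrow> Suc qi \<noteq> 0 \<and> last_in (q qi) m \<le> m \<and>
     src (last_in (q qi) m - 1) \<noteq> root \<and> dst (last_in (q qi) m - 1) = q (Suc qi - 1)"
    using last_in_le last_in_edge[of "q qi" m] by auto
  then show "peel_inv (last_in (q qi) m) (Suc qi) qn q deg h"
    using inv assms(2) unfolding peel_inv_def pend proc by simp
qed

text \<open>Exactly the edge \<open>cur - 1\<close> moves from pending to processed. Its source
  \<open>u\<close> still has positive degree while every processed head is peeled, so changing
  \<open>h\<close> at \<open>u\<close> disturbs no right-hand side of the recursion.\<close>

lemma peel_edge:
  assumes inv: "peel_inv cur qi qn q deg h" and cur: "cur \<noteq> 0"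
  defines "u \<equiv> src (cur - 1)" and "v \<equiv> dst (cur - 1)"
  defines "deg' \<equiv> deg(u := deg u - 1)"
  defines "q' \<equiv> if deg' u = 0 then q(qn := u) else q"
  defines "qn' \<equiv> if deg' u = 0 then Suc qn else qn"
  defines "h' \<equiv> h(u := max (h u) (h v) - charge deg' u)"
  defines "cur' \<equiv> last_in v (cur - 1)"
  shows "peel_inv cur' qi qn' q' deg' h'"
    and "pending cur' qi q' = pending cur qi q - {cur - 1}" and "cur - 1 \<in> pending cur qi q"
    and "v \<noteq> u"
proof -
  let ?P = "pending cur qi q" and ?D = "processed cur qi q"
  have I: "qi \<le> qn" "inj_on q {..<qn}" "q ` {..<qn} = {u \<in> touched. deg u = 0}"
    "\<And>u. deg u = card {j \<in> ?P. src j = u}"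
    "\<And>j a b. j \<in> ?D \<Longrightarrow> a < qn \<Longrightarrow> b < qn \<Longrightarrow> q a = src j \<Longrightarrow> q b = dst j \<Longrightarrow> b < a"
    "h root = K" "\<And>u. h u \<le> K"
    "\<And>j. j \<in> ?D \<Longrightarrow> h (dst j) - charge deg (src j) \<le> h (src j)"
    "\<And>u. u \<noteq> root \<Longrightarrow> 0 < h u \<Longrightarrow> \<exists>j\<in>?D. src j = u \<and> h u = h (dst j) - charge deg u"
    and C: "qi \<noteq> 0" "cur - 1 < m" "u \<noteq> root" "v = q (qi - 1)"
    using inv cur unfolding peel_inv_def u_def v_def by auto
  \<comment> \<open>The queue is injective, so no earlier position accounts for the current
    edge.\<close>
  have only: "i = qi - 1" if "i < qi" "q i = v" for i
    using inj_onD[OF I(2), of i "qi - 1"] that C I(1) by auto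
  show mem: "cur - 1 \<in> ?P"
    unfolding pending_def using C only cur by (fastforce simp: u_def v_def)
  have touched: "u \<in> touched" using C(2) by (auto simp: touched_def u_def)
  have "cur - 1 \<in> {j \<in> ?P. src j = u}" using mem by (simp add: u_def)
  then have deg_u: "0 < deg u" unfolding I(4)[of u] using finite_pending by (auto simp: card_gt_0_iff)
  have same: "q' i = q i" if "i < qn" for i using that by (simp add: q'_def)
  have cur_le: "cur' \<le> cur - 1" by (simp add: cur'_def last_in_le)
  \<comment> \<open>Between \<open>cur'\<close> and \<open>cur - 1\<close> the pointer skips no
    listed edge into \<open>v\<close>; the append at \<open>qn\<close> lies beyond the dequeued
    part.\<close>
  have upd: "(\<exists>i<qi. q' i = dst j \<and> (Suc i = qi \<longrightarrow> cur' \<le> j)) \<longleftrightarrow>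
      j = cur - 1 \<or> (\<exists>i<qi. q i = dst j \<and> (Suc i = qi \<longrightarrow> cur \<le> j))"
    if j: "j < m" "src j \<noteq> root" for j
  proof -
    have "(\<exists>i<qi. q' i = dst j \<and> (Suc i = qi \<longrightarrow> cur' \<le> j)) \<longleftrightarrow>
       (\<exists>i<qi. q i = dst j \<and> (Suc i = qi \<longrightarrow> cur' \<le> j))"
      using same I(1) by (metis order_less_le_trans)
    also have "\<dots> \<longleftrightarrow> j = cur - 1 \<or> (\<exists>i<qi. q i = dst j \<and> (Suc i = qi \<longrightarrow> cur \<le> j))" (is "?l \<longleftrightarrow> ?r")
    proof
      assume ?l
      then obtain i where i: "i < qi" "q i = dst j" "Suc i = qi \<longrightarrow> cur' \<le> j" by auto
      show ?r
      proof (cases "Suc i = qi")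
        case True
        then have "dst j = v" "cur' \<le> j" using i C by auto
        then have "\<not> j < cur - 1" using less_last_in[OF _ j(2), of "cur - 1"] by (auto simp: cur'_def)
        then show ?thesis using i by auto
      qed (use i in auto)
    next
      assume ?r
      then show ?l
      proof
        assume "j = cur - 1"
        then show ?l using C cur_le by (intro exI[of _ "qi - 1"]) (auto simp: v_def)
      qed (use cur_le in auto)
    qed
    finally show ?thesis .
  qed
  show pend: "pending cur' qi q' = ?P - {cur - 1}"
    unfolding pending_def using upd by auto
  have proc: "processed cur' qi q' = insert (cur - 1) ?D"
    unfolding processed_def using upd C(2,3) by (auto simp: u_def)
  have v_peeled: "deg v = 0" "v \<in> q ` {..<qn}" using I(1,3) C by auto
  have D_peeled: "deg (dst j) = 0" "\<exists>i<qi. q i = dst j" if "j \<in> ?D" for j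
  proof -
    show "\<exists>i<qi. q i = dst j" using that by (auto simp: processed_def)
    then obtain i where "i < qn" "q i = dst j" using I(1) by (meson less_le_trans)
    then have "dst j \<in> q ` {..<qn}" by force
    then show "deg (dst j) = 0" by (simp add: I(3))
  qed
  have unlike: "v \<noteq> u" "\<And>j. j \<in> ?D \<Longrightarrow> dst j \<noteq> u" using v_peeled D_peeled deg_u by auto
  then show "v \<noteq> u" by simp
  have u_new: "u \<notin> q ` {..<qn}" using I(3) deg_u by auto
  have deg': "deg' w = card {j \<in> pending cur' qi q'. src j = w}" for w
  proof (cases "w = u")
    case True
    have "{j \<in> ?P - {cur - 1}. src j = u} = {j \<in> ?P. src j = u} - {cur - 1}" by auto
    then show ?thesis using True mem finite_pending
      by (simp add: deg'_def pend I(4) u_def)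
  next
    case False
    then have "{j \<in> ?P - {cur - 1}. src j = w} = {j \<in> ?P. src j = w}" by (auto simp: u_def)
    then show ?thesis using False by (simp add: deg'_def pend I(4)[of w])
  qed
  have inj: "inj_on q' {..<qn'}"
    using I(2) u_new by (auto simp: q'_def qn'_def lessThan_Suc inj_on_def)
  have img: "q' ` {..<qn'} = {w \<in> touched. deg' w = 0}"
  proof -
    have "q' ` {..<qn'} = (if deg' u = 0 then insert u (q ` {..<qn}) else q ` {..<qn})"
      by (auto simp: q'_def qn'_def lessThan_Suc)
    then show ?thesis using I(3) touched deg_u by (auto simp: deg'_def)
  qed
  have ord: "b < a" if o: "j \<in> insert (cur - 1) ?D" "a < qn'" "b < qn'" "q' a = src j" "q' b = dst j" for j a b
  proof -
    \<comment> \<open>The head was queued before this step, so it also precedes a source appended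
      now at position \<open>qn\<close>.\<close>
    have bq: "b < qn \<and> q b = dst j"
    proof -
      obtain i where i: "i < qn" "q i = dst j"
      proof (cases "j = cur - 1")
        case True
        then show ?thesis using v_peeled(2) that by (auto simp: v_def)
      next
        case False
        then show ?thesis using o(1) D_peeled(2)[of j] I(1) that by (meson insertE less_le_trans)
      qed
      then have "q' i = q' b" "i < qn'" using same that(5) by (auto simp: qn'_def)
      then have "i = b" using inj_onD[OF inj] that(3) by auto
      then show ?thesis using i by auto
    qed
    show ?thesis
    proof (cases "a < qn")
      case True
      then have a: "q a = src j" using same that by auto
      then have "src j \<noteq> u" using u_new True by (metis imageI lessThan_iff)
      then have "j \<in> ?D" using that(1) by (auto simp: u_def)
      then show ?thesis using True a bq I(5)[of j a b] by auto
    qed (use bq in auto)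
  qed
  have charge: "charge deg' w = charge deg w" if "w \<noteq> u" for w
    using that by (simp add: charge_def deg'_def)
  \<comment> \<open>So far \<open>h u\<close> is a plain maximum; a charge is subtracted at most
    once, when the degree reaches 0.\<close>
  have charge_u: "charge deg u = 0" using deg_u by (simp add: charge_def)
  have h_ge: "h' (dst j) - charge deg' (src j) \<le> h' (src j)" if "j \<in> insert (cur - 1) ?D" for j
  proof (cases "src j = u")
    case True
    have "h (dst j) \<le> max (h u) (h v)"
      using that I(8)[of j] charge_u True by (auto simp: v_def)
    moreover have "dst j \<noteq> u" using that unlike by (auto simp: v_def)
    ultimately show ?thesis using True by (simp add: h'_def diff_le_mono del: max.bounded_iff)
  next
    case False
    then show ?thesis using that I(8)[of j] unlike charge[OF False] by (auto simp: h'_def u_def)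
  qed
  have h_att: "\<exists>j\<in>insert (cur - 1) ?D. src j = w \<and> h' w = h' (dst j) - charge deg' w"
    if w: "w \<noteq> root" "0 < h' w" for w
  proof (cases "w = u")
    case True
    show ?thesis
    \<comment> \<open>The maximum is attained by the new edge, or else by the old witness for
      \<open>h u\<close>, which is positive in that case.\<close>
    proof (cases "h u \<le> h v")
      case True
      then show ?thesis using \<open>w = u\<close> unlike by (auto simp: h'_def u_def v_def max_def)
    next
      case False
      then obtain j where "j \<in> ?D" "src j = u" "h u = h (dst j)"
        using I(9)[OF C(3)] charge_u by auto
      then show ?thesis using False \<open>w = u\<close> unlike by (intro bexI[of _ j]) (auto simp: h'_def)
    qed
  next
    case False
    then obtain j where "j \<in> ?D" "src j = w" "h w = h (dst j) - charge deg w"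
      using I(9)[OF w(1)] w(2) by (auto simp: h'_def)
    then show ?thesis using False unlike charge[OF False] by (intro bexI[of _ j]) (auto simp: h'_def)
  qed
  have "h' root = K" using I(6) C(3) by (simp add: h'_def)
  moreover have "h' w \<le> K" for w using I(7)[of u] I(7)[of v] I(7)[of w] by (auto simp: h'_def max_def)
  moreover have "cur' \<noteq> 0 \<longrightarrow> qi \<noteq> 0 \<and> cur' \<le> m \<and> src (cur' - 1) \<noteq> root \<and> dst (cur' - 1) = q' (qi - 1)"
    using last_in_edge[of v "cur - 1"] C I(1) cur_le same[of "qi - 1"] by (auto simp: cur'_def)
  moreover have "qi \<le> qn'" using I(1) by (simp add: qn'_def)
  ultimately show "peel_inv cur' qi qn' q' deg' h'"
    unfolding peel_inv_def proc using inj img deg' ord h_ge h_att by auto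
qed

text \<open>A source other than the root has positive degree, so apart from the root every touched
  vertex of degree 0 is a head.\<close>

lemma peel_inv_init:
  assumes "inj_on q {..<qn}" "q ` {..<qn} = insert root {u \<in> dst ` {..<m}. deg u = 0}"
    "\<And>u. deg u = card {j. j < m \<and> src j \<noteq> root \<and> src j = u}"
    "h = (\<lambda>_. 0)(root := K)"
  shows "peel_inv 0 0 qn q deg h"
proof -
  have "deg (src j) \<noteq> 0" if "j < m" "src j \<noteq> root" for j
    using that unfolding assms(3) by (auto simp: card_eq_0_iff)
  moreover have "deg root = 0" unfolding assms(3) by (auto simp: card_eq_0_iff)
  ultimately have "q ` {..<qn} = {u \<in> touched. deg u = 0}"
    unfolding assms(2) by (fastforce simp: touched_def)
  moreover have "deg u = card {j \<in> pending 0 0 q. src j = u}" for u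
    unfolding assms(3) pending_def by (simp add: conj_assoc)
  ultimately show ?thesis
    unfolding peel_inv_def using assms(1,4) by (auto simp: processed_def)
qed

definition root_flag :: "(nat \<Rightarrow> nat) \<Rightarrow> (nat \<Rightarrow> nat) \<Rightarrow> nat \<Rightarrow> bool" where
  "root_flag deg h i \<longleftrightarrow> (\<exists>j<i. src j = root \<and> (deg (dst j) \<noteq> 0 \<or> 2 \<le> h (dst j)))"

text \<open>With the queue exhausted, processed edges are those into the queue and pending ones
  those out of it, leaving aside edges from the root. Hence positive degree means having an unpeeled
  successor, and the position in the queue serves as rank.\<close>

lemma peel_inv_final:
  assumes inv: "peel_inv 0 qn qn q deg h"
  shows "winning_set {..<n} (set es) (\<Union>t\<in>T. coBuchi {t}) =
    {u \<in> src ` {..<m}. deg u \<noteq> 0 \<or> root_flag deg h m \<and> 0 < h u}"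
proof -
  define R where "R = {u \<in> touched. deg u = 0}"
  define U where "U = {u \<in> touched. deg u \<noteq> 0}"
  define rank where "rank = the_inv_into {..<qn} q"
  have I: "inj_on q {..<qn}" "q ` {..<qn} = R"
    "\<And>u. deg u = card {j \<in> pending 0 qn q. src j = u}"
    "\<And>j a b. j \<in> processed 0 qn q \<Longrightarrow> a < qn \<Longrightarrow> b < qn \<Longrightarrow> q a = src j \<Longrightarrow> q b = dst j \<Longrightarrow> b < a"
    "h root = K"
    "\<And>j. j \<in> processed 0 qn q \<Longrightarrow> h (dst j) - charge deg (src j) \<le> h (src j)"
    "\<And>u. u \<noteq> root \<Longrightarrow> 0 < h u \<Longrightarrow> \<exists>j\<in>processed 0 qn q. src j = u \<and> h u = h (dst j) - charge deg u"
    using inv unfolding peel_inv_def R_def by auto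
  have proc: "processed 0 qn q = {j. j < m \<and> src j \<noteq> root \<and> dst j \<in> R}"
    unfolding processed_def I(2)[symmetric] by force
  have pend: "pending 0 qn q = {j. j < m \<and> src j \<noteq> root \<and> dst j \<notin> R}"
    unfolding pending_def I(2)[symmetric] by force
  have deg0: "deg u = 0 \<longleftrightarrow> (\<forall>j<m. src j = u \<and> u \<noteq> root \<longrightarrow> dst j \<in> R)" for u
    unfolding I(3)[of u] pend by (auto simp: card_eq_0_iff)
  have touched: "j < m \<Longrightarrow> src j \<in> touched" "j < m \<Longrightarrow> dst j \<in> touched" for j
    by (auto simp: touched_def)
  have rank: "\<exists>i<qn. q i = v \<and> rank v = i" if "v \<in> R" for v
  proof -
    have "v \<in> q ` {..<qn}" using that I(2) by simp
    then show ?thesis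
      using f_the_inv_into_f[OF I(1)] the_inv_into_into[OF I(1), of v "{..<qn}"]
      unfolding rank_def by auto
  qed
  have edge: "\<exists>j<m. src j = u \<and> dst j = v" if "(u, v) \<in> set es" for u v
    using that by (auto simp: set_es)
  interpret peeling "{..<n}" "set es" T root R U h rank
  proof
    show "set es \<subseteq> {..<n} \<times> {..<n}" using es_n .
    show "finite T" by (simp add: T_def)
    show "T \<subseteq> {..<n}" by (rule T_n)
    show "root \<in> T" by (rule root_T)
    have "deg root = 0" using deg0 by auto
    then show "root \<in> R" "root \<notin> U" by (auto simp: R_def U_def touched_def)
    show "U \<subseteq> {..<n}" using touched_less by (auto simp: U_def)
    show "v \<in> R \<and> rank v < rank u" if uv: "(u, v) \<in> set es" "u \<in> R" "u \<noteq> root" for u v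
    proof -
      obtain j where j: "j < m" "src j = u" "dst j = v" using edge[OF uv(1)] by auto
      have "deg u = 0" using uv(2) by (simp add: R_def)
      then have v: "v \<in> R" using uv(3) deg0[of u] j by auto
      show ?thesis using v I(4)[of j] j uv rank[OF v] rank[OF uv(2)] by (auto simp: proc)
    qed
    show "\<exists>v\<in>U. (u, v) \<in> set es" if u: "u \<in> U" for u
    proof -
      obtain j where "j < m" "src j = u" "dst j \<notin> R" using u deg0[of u] by (auto simp: U_def)
      then show ?thesis using touched by (auto simp: U_def R_def set_es)
    qed
    show "u \<in> R \<or> u \<in> U" if "(u, v) \<in> set es" for u v
      using edge[OF that] touched by (auto simp: R_def U_def)
    show "h root = card T" using I(5) card_T by simp
    show "h v - of_bool (u \<in> T) \<le> h u" if uv: "(u, v) \<in> set es" "u \<in> R" "u \<noteq> root" for u v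
    proof -
      obtain j where j: "j < m" "src j = u" "dst j = v" using edge[OF uv(1)] by auto
      then have "j \<in> processed 0 qn q" using uv deg0[of u] by (auto simp: proc R_def)
      from I(6)[OF this] show ?thesis using j uv(2) by (simp add: charge_def R_def)
    qed
    show "\<exists>v. (u, v) \<in> set es \<and> h u = h v - of_bool (u \<in> T)" if "u \<in> R" "u \<noteq> root" "0 < h u" for u
      using I(7)[OF that(2,3)] that(1) by (auto simp: proc charge_def R_def set_es)
  qed
  have flag: "root_wins \<longleftrightarrow> root_flag deg h m"
  proof
    assume root_wins
    then obtain w where "(root, w) \<in> set es" "w \<in> U \<or> w \<in> R \<and> 2 \<le> h w"
      by (auto simp: root_wins_def)
    then show "root_flag deg h m" using edge[of root w] by (auto simp: root_flag_def U_def)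
  next
    assume "root_flag deg h m"
    then obtain j where j: "j < m" "src j = root" "deg (dst j) \<noteq> 0 \<or> 2 \<le> h (dst j)"
      by (auto simp: root_flag_def)
    then have "(root, dst j) \<in> set es" by (force simp: set_es)
    moreover have "dst j \<in> U \<or> dst j \<in> R \<and> 2 \<le> h (dst j)"
      using j touched(2)[of j] by (auto simp: U_def R_def)
    ultimately show root_wins by (auto simp: root_wins_def)
  qed
  \<comment> \<open>A winning vertex starts a play and is therefore a source; this lets the output
    range over sources.\<close>
  have "U \<union> {u \<in> R. root_wins \<and> 0 < h u} \<subseteq> src ` {..<m}"
  proof -
    have "winning_set {..<n} (set es) (\<Union>t\<in>T. coBuchi {t}) \<subseteq> fst ` set es"
      by (force simp: winning_set_def plays_def)
    also have "\<dots> = src ` {..<m}" by (auto simp: set_es image_image)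
    finally show ?thesis by (simp add: winning_set_eq)
  qed
  then show ?thesis
    unfolding winning_set_eq using flag touched by (auto simp: U_def R_def)
qed

section \<open>Loop invariants on machine states\<close>

lemma B_ge: "n + 5 * m + 6 \<le> B" by (simp add: B_def)

section \<open>Invariants of the phases\<close>

definition edges_in :: "state \<Rightarrow> bool" where
  "edges_in s \<longleftrightarrow> vars s r_m = m \<and> arrs s a_src = src \<and> arrs s a_dst = dst"

definition marks :: "nat \<Rightarrow> nat \<Rightarrow> nat" where
  "marks j = (\<lambda>v. of_bool (v \<in> set (take j ts)))"

lemma marks_0: "marks 0 = (\<lambda>_. 0)" by (simp add: marks_def)

lemma marks_Suc: "j < K \<Longrightarrow> marks (Suc j) = (marks j)(tgt j := 1)"
  using K_le(2) by (auto simp: marks_def tgt_def take_Suc_conv_app_nth)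

definition deg_upto :: "nat \<Rightarrow> nat \<Rightarrow> nat" where
  "deg_upto j = (\<lambda>u. card {i. i < j \<and> src i \<noteq> root \<and> src i = u})"

lemma deg_upto_0: "deg_upto 0 = (\<lambda>_. 0)" by (simp add: deg_upto_def)

lemma deg_upto_le: "deg_upto j u \<le> j"
proof -
  have "deg_upto j u \<le> card {..<j}" unfolding deg_upto_def by (intro card_mono) auto
  then show ?thesis by simp
qed

lemma deg_upto_Suc:
  "deg_upto (Suc j) = (if src j = root then deg_upto j
    else (deg_upto j)(src j := Suc (deg_upto j (src j))))"
proof
  fix u
  have "{i. i < Suc j \<and> src i \<noteq> root \<and> src i = u} =
    (if src j \<noteq> root \<and> src j = u then insert j {i. i < j \<and> src i \<noteq> root \<and> src i = u}
     else {i. i < j \<and> src i \<noteq> root \<and> src i = u})"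
    by (auto simp: less_Suc_eq)
  then show "deg_upto (Suc j) u = (if src j = root then deg_upto j
    else (deg_upto j)(src j := Suc (deg_upto j (src j)))) u"
    by (simp add: deg_upto_def)
qed

text \<open>The clauses on zero arrays hand the initial memory on to later phases, so that no loop
  has to clear them.\<close>

definition mark_inv :: "state \<Rightarrow> bool" where
  "mark_inv s \<longleftrightarrow> edges_in s \<and> vars s r_K = K \<and> vars s r_j \<le> K \<and> arrs s a_ts = tgt \<and>
    arrs s a_tgt = marks (vars s r_j) \<and> arrs s a_deg = (\<lambda>_. 0) \<and> arrs s a_head = (\<lambda>_. 0) \<and>
    arrs s a_inq = (\<lambda>_. 0) \<and> arrs s a_h = (\<lambda>_. 0) \<and> arrs s a_done = (\<lambda>_. 0)"

definition link_inv :: "state \<Rightarrow> bool" where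
  "link_inv s \<longleftrightarrow> edges_in s \<and> vars s r_K = K \<and> vars s r_root = root \<and> vars s r_j \<le> m \<and>
    arrs s a_tgt = marks K \<and> arrs s a_deg = deg_upto (vars s r_j) \<and>
    arrs s a_head = (\<lambda>v. last_in v (vars s r_j)) \<and>
    (\<forall>i<vars s r_j. src i \<noteq> root \<longrightarrow> arrs s a_next (Suc i) = last_in (dst i) i) \<and>
    arrs s a_inq = (\<lambda>_. 0) \<and> arrs s a_h = (\<lambda>_. 0) \<and> arrs s a_done = (\<lambda>_. 0)"

definition linked :: "state \<Rightarrow> bool" where
  "linked s \<longleftrightarrow> edges_in s \<and> vars s r_root = root \<and>
    arrs s a_tgt = marks K \<and> arrs s a_head = (\<lambda>v. last_in v m) \<and>
    (\<forall>i<m. src i \<noteq> root \<longrightarrow> arrs s a_next (Suc i) = last_in (dst i) i) \<and>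
    arrs s a_done = (\<lambda>_. 0)"

definition sink_inv :: "state \<Rightarrow> bool" where
  "sink_inv s \<longleftrightarrow> linked s \<and> vars s r_j \<le> m \<and> arrs s a_deg = deg_upto m \<and>
    arrs s a_h = (\<lambda>_. 0)(root := K) \<and> vars s r_qn \<le> Suc (vars s r_j) \<and>
    inj_on (arrs s a_queue) {..<vars s r_qn} \<and>
    arrs s a_queue ` {..<vars s r_qn} =
      insert root {u \<in> dst ` {..<vars s r_j}. deg_upto m u = 0} \<and>
    arrs s a_inq = (\<lambda>v. of_bool (v \<in> arrs s a_queue ` {..<vars s r_qn}))"

definition peel_state_inv :: "state \<Rightarrow> bool" where
  "peel_state_inv s \<longleftrightarrow> linked s \<and> peel_inv (vars s r_cur) (vars s r_qi) (vars s r_qn)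
    (arrs s a_queue) (arrs s a_deg) (arrs s a_h)"

text \<open>Dequeuing lowers the first summand and keeps the second; reading an edge does the
  opposite.\<close>

definition peel_measure :: "state \<Rightarrow> nat" where
  "peel_measure s = (2 * m + 1 - vars s r_qi) +
    card (pending (vars s r_cur) (vars s r_qi) (arrs s a_queue))"

definition peeled_state :: "(nat \<Rightarrow> nat) \<Rightarrow> (nat \<Rightarrow> nat) \<Rightarrow> state \<Rightarrow> bool" where
  "peeled_state deg h s \<longleftrightarrow> edges_in s \<and> vars s r_root = root \<and> arrs s a_deg = deg \<and> arrs s a_h = h \<and>
    (\<forall>u. deg u \<le> m) \<and> (\<forall>u. h u \<le> K)"

definition root_inv :: "(nat \<Rightarrow> nat) \<Rightarrow> (nat \<Rightarrow> nat) \<Rightarrow> state \<Rightarrow> bool" where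
  "root_inv deg h s \<longleftrightarrow> peeled_state deg h s \<and> vars s r_j \<le> m \<and> arrs s a_done = (\<lambda>_. 0) \<and>
    vars s r_b = of_bool (root_flag deg h (vars s r_j))"

definition output_inv :: "(nat \<Rightarrow> nat) \<Rightarrow> (nat \<Rightarrow> nat) \<Rightarrow> state \<Rightarrow> bool" where
  "output_inv deg h s \<longleftrightarrow> peeled_state deg h s \<and> vars s r_j \<le> m \<and>
    vars s r_b = of_bool (root_flag deg h m) \<and> vars s r_out \<le> vars s r_j \<and>
    inj_on (arrs s a_out) {..<vars s r_out} \<and>
    arrs s a_out ` {..<vars s r_out} =
      {u \<in> src ` {..<vars s r_j}. deg u \<noteq> 0 \<or> root_flag deg h m \<and> 0 < h u} \<and>
    arrs s a_done = (\<lambda>u. of_bool (u \<in> arrs s a_out ` {..<vars s r_out}))"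

section \<open>Each phase preserves its invariant within the word bound\<close>

lemma init_targets_ok:
  "run_fits B init_targets (input_state n es ts) \<and> mark_inv (run init_targets (input_state n es ts))"
proof -
  have "length es = m" by (simp add: m_def)
  then show ?thesis using B_ge length_ts
    by (auto simp: init_targets_def mark_inv_def edges_in_def input_state_def marks_0 K_def
        src_def dst_def tgt_def fun_eq_iff)
qed

lemma mark_step:
  assumes "mark_inv s" "vars s r_j < K"
  shows "run_fits B mark_body s \<and> mark_inv (run mark_body s) \<and> vars (run mark_body s) r_j = Suc (vars s r_j)"
  using assms B_ge K_le length_ts tgt_less[OF assms(2)]
  by (auto simp: mark_body_def incr_def mark_inv_def edges_in_def marks_Suc)

lemma init_link_ok:
  assumes "mark_inv s" "\<not> vars s r_j < K"
  shows "run_fits B init_link s \<and> link_inv (run init_link s)"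
proof -
  have "tgt 0 = root" using ts_nonempty by (simp add: tgt_def root_def)
  then show ?thesis using assms B_ge root_less
    by (auto simp: init_link_def mark_inv_def link_inv_def edges_in_def deg_upto_0)
qed

lemma link_step:
  assumes "link_inv s" "vars s r_j < m"
  shows "run_fits B link_body s \<and> link_inv (run link_body s) \<and> vars (run link_body s) r_j = Suc (vars s r_j)"
proof -
  let ?j = "vars s r_j"
  have b: "src ?j < n" "dst ?j < n" using assms(2) src_less dst_less by auto
  have b': "deg_upto ?j (src ?j) \<le> ?j" "last_in (dst ?j) ?j \<le> ?j" by (simp_all add: deg_upto_le last_in_le)
  show ?thesis
  proof (cases "src ?j = root")
    case True
    then show ?thesis using assms B_ge b root_less
      by (auto simp: link_body_def incr_def link_inv_def edges_in_def deg_upto_Suc less_Suc_eq)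
  next
    case False
    then show ?thesis using assms B_ge b b' root_less
      by (auto simp: link_body_def incr_def link_inv_def edges_in_def deg_upto_Suc less_Suc_eq)
  qed
qed

lemma init_sinks_ok:
  assumes "link_inv s" "\<not> vars s r_j < m"
  shows "run_fits B init_sinks s \<and> sink_inv (run init_sinks s)"
  using assms B_ge root_less K_le inj_on_snoc[of "arrs s a_queue" 0 root]
  by (auto simp: init_sinks_def incr_def enqueue_def link_inv_def linked_def sink_inv_def edges_in_def)

lemma sink_step:
  assumes "sink_inv s" "vars s r_j < m"
  shows "run_fits B sink_body s \<and> sink_inv (run sink_body s) \<and> vars (run sink_body s) r_j = Suc (vars s r_j)"
proof -
  let ?j = "vars s r_j" and ?q = "arrs s a_queue" and ?l = "vars s r_qn"
  have "dst ?j < n" "deg_upto m (dst ?j) \<le> m" using assms(2) dst_less deg_upto_le by auto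
  then have b: "dst ?j \<le> B" "deg_upto m (dst ?j) \<le> B" using B_ge by auto
  show ?thesis
  proof (cases "deg_upto m (dst ?j) = 0 \<and> dst ?j \<notin> ?q ` {..<?l}")
    case True
    then show ?thesis using assms B_ge b
      by (simp add: sink_body_def incr_def enqueue_def sink_inv_def linked_def edges_in_def
          inj_on_snoc image_snoc flag_snoc Collect_image_snoc insert_commute del: fun_upd_image cong del: image_cong_simp)
        (auto simp: fun_eq_iff)
  next
    case False
    then show ?thesis using assms B_ge b
      by (auto simp: sink_body_def incr_def enqueue_def sink_inv_def linked_def edges_in_def
          Collect_image_snoc)
  qed
qed

lemma init_peel_ok:
  assumes "sink_inv s" "\<not> vars s r_j < m"
  shows "run_fits B init_peel s \<and> peel_state_inv (run init_peel s) \<and> peel_measure (run init_peel s) \<le> 3 * m + 1"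
proof -
  have j: "vars s r_j = m" using assms by (auto simp: sink_inv_def)
  have "peel_inv 0 0 (vars s r_qn) (arrs s a_queue) (arrs s a_deg) (arrs s a_h)"
    using assms(1) j by (intro peel_inv_init) (auto simp: sink_inv_def deg_upto_def)
  moreover have "card (pending cur qi q) \<le> m" for cur qi q
    using card_mono[OF _ pending_subset] by auto
  ultimately show ?thesis using assms(1) B_ge
    by (auto simp: init_peel_def peel_state_inv_def peel_measure_def sink_inv_def linked_def edges_in_def)
qed

lemma peel_cond_fits:
  assumes "peel_state_inv s"
  shows "cfits B s (Less (Var r_qi) (Add (Var r_qn) (Var r_cur)))"
proof -
  have "vars s r_qn \<le> 2 * m + 1" "vars s r_qi \<le> vars s r_qn" "vars s r_cur \<le> m"
    using assms peel_inv_length peel_inv_bounds unfolding peel_state_inv_def by blast+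
  then show ?thesis using B_ge by simp
qed

lemma peel_step:
  assumes inv: "peel_state_inv s" and "vars s r_qi < vars s r_qn + vars s r_cur"
  shows "run_fits B peel_body s \<and> peel_state_inv (run peel_body s) \<and>
    peel_measure (run peel_body s) < peel_measure s"
proof -
  let ?c = "vars s r_cur" and ?i = "vars s r_qi" and ?l = "vars s r_qn"
    and ?q = "arrs s a_queue" and ?d = "arrs s a_deg" and ?h = "arrs s a_h"
  have L: "linked s" and P: "peel_inv ?c ?i ?l ?q ?d ?h" using inv by (auto simp: peel_state_inv_def)
  have l: "?l \<le> 2 * m + 1" and d: "?d u \<le> m" and h: "?h u \<le> K" and il: "?i \<le> ?l" for u
    using peel_inv_length[OF P] peel_inv_deg[OF P] peel_inv_bounds[OF P] by auto
  show ?thesis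
  proof (cases "?c = 0")
    case True
    then have lt: "?i < ?l" using assms(2) by simp
    then have "?q ?i \<in> touched" using P by (auto simp: peel_inv_def)
    then have "?q ?i < n" by (rule touched_less)
    then show ?thesis
      using True lt l L B_ge peel_next_vertex[OF P[unfolded True] lt] last_in_le[of "?q ?i" m]
      by (auto simp: peel_body_def incr_def peel_state_inv_def peel_measure_def linked_def edges_in_def)
  next
    case False
    let ?e = "?c - 1"
    let ?u = "src ?e" and ?v = "dst ?e"
    have e: "?e < m" "?u \<noteq> root" using P False by (auto simp: peel_inv_def)
    have b: "?u < n" "?v < n" "?c \<le> m" using e src_less dst_less by auto
    \<comment> \<open>\<open>a_next\<close> is indexed by pointers, and
      \<open>?c = Suc ?e\<close>.\<close>
    have nxt: "arrs s a_next ?c = last_in ?v ?e"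
      using L e False by (auto simp: linked_def dest: spec[of _ ?e])
    have next_le: "last_in ?v ?e \<le> ?e" by (rule last_in_le)
    note step = peel_edge[OF P False]
    have less: "card (pending ?c ?i ?q - {?e}) < card (pending ?c ?i ?q)"
      using step(3) finite_pending by (intro psubset_card_mono) auto
    have mk: "arrs s a_tgt ?u = of_bool (?u \<in> T)" "arrs s a_tgt ?u \<le> 1" using L by (auto simp: linked_def marks_def T_def)
    let ?d' = "?d(?u := ?d ?u - 1)"
    let ?s' = "run peel_body s"
    have fits: "?u \<le> B" "?v \<le> B" "?e \<le> B" "?c \<le> B" "?l + 1 \<le> B" "1 \<le> B"
      "?d ?u \<le> B" "?d ?u - 1 \<le> B" "?h ?u \<le> B" "?h ?v \<le> B" "last_in ?v ?e \<le> B" "arrs s a_tgt ?u \<le> B"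
    proof -
      have mB: "m \<le> B" "n \<le> B" "K \<le> B" "2 * m + 2 \<le> B" "1 \<le> B" using B_ge K_le by auto
      show "?u \<le> B" "?v \<le> B" using b mB(2) by (auto intro: less_imp_le less_le_trans)
      show "?c \<le> B" "?e \<le> B" using b(3) e(1) mB(1) by (auto intro: less_imp_le less_le_trans order_trans)
      then show "last_in ?v ?e \<le> B" using next_le by (auto intro: order_trans)
      show "?d ?u \<le> B" "?h ?u \<le> B" "?h ?v \<le> B" using order_trans[OF d mB(1)] order_trans[OF h mB(3)] by auto
      then show "?d ?u - 1 \<le> B" by (auto intro: order_trans[OF diff_le_self])
      show "?l + 1 \<le> B" "1 \<le> B" using l mB by auto
      show "arrs s a_tgt ?u \<le> B" using mk(2) mB(5) by (rule order_trans)
    qed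
    have L': "arrs s a_src = src" "arrs s a_dst = dst" using L by (auto simp: linked_def edges_in_def)
    note facts = False fits nxt mk(1) step(4) L'
    \<comment> \<open>The state in the form of \<open>peel_edge\<close>: the comparison computes
      \<open>max\<close>, and subtracting \<open>a_tgt\<close> at degree 0 is
      \<open>charge\<close>.\<close>
    have "run_fits B peel_body s \<and> vars ?s' r_cur = last_in ?v ?e \<and> vars ?s' r_qi = ?i \<and>
      vars ?s' r_qn = (if ?d' ?u = 0 then Suc ?l else ?l) \<and>
      arrs ?s' a_queue = (if ?d' ?u = 0 then ?q(?l := ?u) else ?q) \<and>
      arrs ?s' a_deg = ?d' \<and> arrs ?s' a_h = ?h(?u := max (?h ?u) (?h ?v) - charge ?d' ?u) \<and>
      vars ?s' r_m = vars s r_m \<and> vars ?s' r_root = vars s r_root \<and> arrs ?s' a_src = src \<and>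
      arrs ?s' a_dst = dst \<and> arrs ?s' a_tgt = arrs s a_tgt \<and> arrs ?s' a_head = arrs s a_head \<and>
      arrs ?s' a_next = arrs s a_next \<and> arrs ?s' a_done = arrs s a_done"
    proof (cases "?h ?u < ?h ?v")
      case True
      then have "max (?h ?u) (?h ?v) = ?h ?v" by simp
      with True show ?thesis using facts
        by (cases "?d ?u - 1 = 0") (simp_all add: peel_body_def incr_def enqueue_def charge_def)
    next
      case False
      then have "max (?h ?u) (?h ?v) = ?h ?u" by simp
      with False show ?thesis using facts
        by (cases "?d ?u - 1 = 0") (simp_all add: peel_body_def incr_def enqueue_def charge_def)
    qed
    then show ?thesis
      using L step(1,2) less unfolding peel_state_inv_def peel_measure_def linked_def edges_in_def
      by simp
  qed
qed

lemma init_root_ok: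
  assumes "peel_state_inv s"
  shows "run_fits B init_root s \<and> root_inv (arrs s a_deg) (arrs s a_h) (run init_root s)"
proof -
  have P: "peel_inv (vars s r_cur) (vars s r_qi) (vars s r_qn) (arrs s a_queue) (arrs s a_deg) (arrs s a_h)"
    using assms by (simp add: peel_state_inv_def)
  then have "arrs s a_deg u \<le> m" "arrs s a_h u \<le> K" for u
    using peel_inv_deg[OF P] peel_inv_bounds[OF P] by auto
  then show ?thesis using assms B_ge
    by (auto simp: init_root_def root_inv_def peeled_state_def peel_state_inv_def linked_def
        edges_in_def root_flag_def)
qed

lemma root_step:
  assumes "root_inv deg h s" "vars s r_j < m"
  shows "run_fits B root_body s \<and> root_inv deg h (run root_body s) \<and>
    vars (run root_body s) r_j = Suc (vars s r_j)"
proof -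
  let ?j = "vars s r_j"
  have b: "src ?j < n" "dst ?j < n" using assms(2) src_less dst_less by auto
  have "deg (dst ?j) \<le> m" "h (dst ?j) \<le> K" using assms(1) by (auto simp: root_inv_def peeled_state_def)
  then have b': "deg (dst ?j) \<le> B" "h (dst ?j) \<le> B" using B_ge K_le by auto
  have "root_flag deg h (Suc ?j) \<longleftrightarrow>
      (src ?j = root \<and> \<not> (deg (dst ?j) = 0 \<and> h (dst ?j) < 2)) \<or> root_flag deg h ?j"
    by (auto simp: root_flag_def less_Suc_eq not_less)
  then show ?thesis using assms B_ge b b' root_less K_le
    by (auto simp: root_body_def incr_def root_inv_def peeled_state_def edges_in_def)
qed

lemma init_output_ok:
  assumes "root_inv deg h s" "\<not> vars s r_j < m"
  shows "run_fits B init_output s \<and> output_inv deg h (run init_output s)"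
  using assms B_ge by (auto simp: init_output_def root_inv_def output_inv_def peeled_state_def edges_in_def)

lemma output_step:
  assumes "output_inv deg h s" "vars s r_j < m"
  shows "run_fits B output_body s \<and> output_inv deg h (run output_body s) \<and>
    vars (run output_body s) r_j = Suc (vars s r_j)"
proof -
  let ?j = "vars s r_j" and ?q = "arrs s a_out" and ?l = "vars s r_out"
  have "src ?j < n" "deg (src ?j) \<le> m" "h (src ?j) \<le> K"
    using assms src_less by (auto simp: output_inv_def peeled_state_def)
  then have b: "src ?j \<le> B" "deg (src ?j) \<le> B" "h (src ?j) \<le> B" using B_ge K_le by auto
  show ?thesis
  proof (cases "src ?j \<notin> ?q ` {..<?l} \<and> (deg (src ?j) \<noteq> 0 \<or> root_flag deg h m \<and> 0 < h (src ?j))")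
    case True
    then show ?thesis using assms B_ge b K_le
      by (simp add: output_body_def incr_def output_inv_def peeled_state_def edges_in_def
          inj_on_snoc image_snoc flag_snoc Collect_image_snoc del: fun_upd_image cong del: image_cong_simp)
        (auto simp: fun_eq_iff)
  next
    case False
    then show ?thesis using assms B_ge b K_le
      by (auto simp: output_body_def incr_def output_inv_def peeled_state_def edges_in_def
          Collect_image_snoc)
  qed
qed

section \<open>Running times of the loops and of the whole program\<close>

lemma runs_for_edges:
  assumes "I s" "\<And>s. I s \<Longrightarrow> edges_in s \<and> vars s r_j \<le> m"
    and "\<And>s. I s \<Longrightarrow> vars s r_j < m \<Longrightarrow> run_fits B p s \<and> I (run p s) \<and> vars (run p s) r_j = Suc (vars s r_j)"
  shows "runs B (for_edges p) s ((m + 1) * (4 + run_time p)) (\<lambda>s. I s \<and> \<not> vars s r_j < m)"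
proof -
  have [simp]: "vars s (Suc 0) = m" if "I s" for s
    using assms(2)[OF that] by (simp add: edges_in_def)
  \<comment> \<open>One evaluation of the loop test costs 4.\<close>
  have "runs B (for_edges p) s ((m + 1) * (1 + ccost (Less (Var r_j) (Var r_m)) + run_time p))
      (\<lambda>s. I s \<and> \<not> holds s (Less (Var r_j) (Var r_m)))"
    unfolding for_edges_def
  proof (rule runs_While[where \<mu> = "\<lambda>s. m - vars s r_j"])
    show "I s" by (rule assms(1))
    show "m - vars s r_j \<le> m" by simp
    show "cfits B s (Less (Var r_j) (Var r_m))" if "I s" for s
      using assms(2)[OF that] that B_ge by simp
    show "run_fits B p s \<and> I (run p s) \<and> m - vars (run p s) r_j < m - vars s r_j"
      if "I s" "holds s (Less (Var r_j) (Var r_m))" for s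
      using assms(3)[OF that(1)] that by auto
  qed
  then show ?thesis by (rule runs_weaken) (auto simp: algebra_simps)
qed

lemma loop_bounds:
  "link_inv s \<Longrightarrow> edges_in s \<and> vars s r_j \<le> m"
  "sink_inv s \<Longrightarrow> edges_in s \<and> vars s r_j \<le> m"
  "root_inv deg h s \<Longrightarrow> edges_in s \<and> vars s r_j \<le> m"
  "output_inv deg h s \<Longrightarrow> edges_in s \<and> vars s r_j \<le> m"
  by (simp_all add: link_inv_def sink_inv_def linked_def root_inv_def output_inv_def peeled_state_def)

text \<open>There are at most \<open>K \<le> m + 1\<close> iterations however long the target list
  is, which keeps its length out of the time bound.\<close>

lemma runs_marking:
  assumes "mark_inv s"
  shows "runs B (WHILE (Less (Var r_j) (Var r_K)) mark_body) s ((m + 2) * (4 + run_time mark_body))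
    (\<lambda>s. mark_inv s \<and> \<not> vars s r_j < K)"
proof -
  have [simp]: "vars s r_K = K" "vars s r_j \<le> K" if "mark_inv s" for s
    using that by (simp_all add: mark_inv_def)
  have "runs B (WHILE (Less (Var r_j) (Var r_K)) mark_body) s
      ((m + 1 + 1) * (1 + ccost (Less (Var r_j) (Var r_K)) + run_time mark_body))
      (\<lambda>s. mark_inv s \<and> \<not> holds s (Less (Var r_j) (Var r_K)))"
  proof (rule runs_While[where \<mu> = "\<lambda>s. K - vars s r_j"])
    show "mark_inv s" by (rule assms)
    show "K - vars s r_j \<le> m + 1" using K_le by simp
    show "cfits B s (Less (Var r_j) (Var r_K))" if inv: "mark_inv s" for s
    proof -
      have "vars s r_j \<le> K" "K \<le> B" using inv B_ge K_le by auto
      then have "vars s r_j \<le> B" by (rule order_trans)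
      then show ?thesis using inv \<open>K \<le> B\<close> by simp
    qed
    show "run_fits B mark_body s \<and> mark_inv (run mark_body s) \<and>
        K - vars (run mark_body s) r_j < K - vars s r_j"
      if "mark_inv s" "holds s (Less (Var r_j) (Var r_K))" for s
      using mark_step[OF that(1)] that by auto
  qed
  then show ?thesis by (rule runs_weaken) (auto simp: algebra_simps)
qed

text \<open>The potential starts at no more than \<open>2 * m + 1\<close> dequeuings plus
  \<open>m\<close> edges; a test costs 6.\<close>

lemma runs_peeling:
  assumes "peel_state_inv s" "peel_measure s \<le> 3 * m + 1"
  shows "runs B (WHILE (Less (Var r_qi) (Add (Var r_qn) (Var r_cur))) peel_body) s
    ((3 * m + 2) * (6 + run_time peel_body))
    (\<lambda>s. peel_state_inv s \<and> \<not> vars s r_qi < vars s r_qn + vars s r_cur)"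
proof -
  have "runs B (WHILE (Less (Var r_qi) (Add (Var r_qn) (Var r_cur))) peel_body) s
    ((3 * m + 1 + 1) * (1 + ccost (Less (Var r_qi) (Add (Var r_qn) (Var r_cur))) + run_time peel_body))
    (\<lambda>s. peel_state_inv s \<and> \<not> holds s (Less (Var r_qi) (Add (Var r_qn) (Var r_cur))))"
    by (rule runs_While[where \<mu> = peel_measure])
      (use assms peel_cond_fits peel_step in \<open>auto simp del: cfits.simps\<close>)
  then show ?thesis by (rule runs_weaken) (auto simp: algebra_simps)
qed

lemma peeled_winning:
  assumes "peel_state_inv s" "\<not> vars s r_qi < vars s r_qn + vars s r_cur"
  shows "winning_set {..<n} (set es) (\<Union>t\<in>T. coBuchi {t}) =
    {u \<in> src ` {..<m}. arrs s a_deg u \<noteq> 0 \<or>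
      root_flag (arrs s a_deg) (arrs s a_h) m \<and> 0 < arrs s a_h u}"
proof -
  have P: "peel_inv (vars s r_cur) (vars s r_qi) (vars s r_qn) (arrs s a_queue) (arrs s a_deg) (arrs s a_h)"
    using assms(1) by (simp add: peel_state_inv_def)
  have "vars s r_cur = 0" "vars s r_qi = vars s r_qn"
    using assms(2) peel_inv_bounds(1)[OF P] by auto
  then show ?thesis using peel_inv_final P by simp
qed

lemma runs_solve:
  "runs B solve (input_state n es ts) (1000 * (m + 1))
    (\<lambda>s. lists_set (output_list s) (winning_set {..<n} (set es) (\<Union>t\<in>T. coBuchi {t})))"
proof -
  let ?W = "winning_set {..<n} (set es) (\<Union>t\<in>T. coBuchi {t})"
  let ?peeled = "\<lambda>deg h. ?W = {u \<in> src ` {..<m}. deg u \<noteq> 0 \<or> root_flag deg h m \<and> 0 < h u}"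
  have out: "runs B (Seq init_output (for_edges output_body)) s
      (run_time init_output + (m + 1) * (4 + run_time output_body)) (\<lambda>s. lists_set (output_list s) ?W)"
    if s: "root_inv deg h s" "\<not> vars s r_j < m" and W: "?peeled deg h" for deg h s
  proof (rule runs_Seq)
    show "runs B init_output s (run_time init_output) (output_inv deg h)"
      using init_output_ok[OF s] by (intro runs_straight) auto
    fix s assume "output_inv deg h s"
    then have "runs B (for_edges output_body) s ((m + 1) * (4 + run_time output_body))
        (\<lambda>s. output_inv deg h s \<and> \<not> vars s r_j < m)"
      by (rule runs_for_edges[OF _ loop_bounds(4) output_step])
    then show "runs B (for_edges output_body) s ((m + 1) * (4 + run_time output_body))
        (\<lambda>s. lists_set (output_list s) ?W)"
    proof (rule runs_weaken)
      fix s assume "output_inv deg h s \<and> \<not> vars s r_j < m"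
      then have inv: "output_inv deg h s" "vars s r_j = m" by (auto simp: output_inv_def)
      then have "inj_on (arrs s a_out) {..<vars s r_out}" "arrs s a_out ` {..<vars s r_out} = ?W"
        unfolding W output_inv_def by auto
      then show "lists_set (output_list s) ?W"
        by (simp add: lists_set_def output_list_def distinct_map atLeast0LessThan)
    qed simp
  qed
  have rt: "runs B (Seq init_root (Seq (for_edges root_body) (Seq init_output (for_edges output_body)))) s
      (run_time init_root + ((m + 1) * (4 + run_time root_body) + (run_time init_output + (m + 1) * (4 + run_time output_body))))
      (\<lambda>s. lists_set (output_list s) ?W)"
    if s: "peel_state_inv s" "\<not> vars s r_qi < vars s r_qn + vars s r_cur" for s
  proof (rule runs_Seq[OF _ runs_Seq])
    \<comment> \<open>The arrays are frozen at the end of peeling and become parameters of the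
      remaining invariants.\<close>
    let ?d = "arrs s a_deg" and ?h = "arrs s a_h"
    show "runs B init_root s (run_time init_root) (root_inv ?d ?h)"
      using init_root_ok[OF s(1)] by (intro runs_straight) auto
    show "runs B (for_edges root_body) s' ((m + 1) * (4 + run_time root_body))
      (\<lambda>s. root_inv ?d ?h s \<and> \<not> vars s r_j < m)" if "root_inv ?d ?h s'" for s'
      using that by (rule runs_for_edges[OF _ loop_bounds(3) root_step])
    show "runs B (Seq init_output (for_edges output_body)) s'
      (run_time init_output + (m + 1) * (4 + run_time output_body)) (\<lambda>s. lists_set (output_list s) ?W)"
      if "root_inv ?d ?h s' \<and> \<not> vars s' r_j < m" for s'
      using that out peeled_winning[OF s] by blast
  qed
  have mark: "runs B init_targets (input_state n es ts) (run_time init_targets) mark_inv"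
    using init_targets_ok by (intro runs_straight) auto
  have link: "runs B init_link s (run_time init_link) link_inv" if "mark_inv s \<and> \<not> vars s r_j < K" for s
    using init_link_ok that by (intro runs_straight) auto
  have linking: "runs B (for_edges link_body) s ((m + 1) * (4 + run_time link_body))
      (\<lambda>s. link_inv s \<and> \<not> vars s r_j < m)" if "link_inv s" for s
    using that by (rule runs_for_edges[OF _ loop_bounds(1) link_step])
  have sinks: "runs B init_sinks s (run_time init_sinks) sink_inv" if "link_inv s \<and> \<not> vars s r_j < m" for s
    using init_sinks_ok that by (intro runs_straight) auto
  have sinking: "runs B (for_edges sink_body) s ((m + 1) * (4 + run_time sink_body))
      (\<lambda>s. sink_inv s \<and> \<not> vars s r_j < m)" if "sink_inv s" for s
    using that by (rule runs_for_edges[OF _ loop_bounds(2) sink_step])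
  have peel: "runs B init_peel s (run_time init_peel) (\<lambda>s. peel_state_inv s \<and> peel_measure s \<le> 3 * m + 1)"
    if "sink_inv s \<and> \<not> vars s r_j < m" for s
    using init_peel_ok that by (intro runs_straight) auto
  have peeling: "runs B (WHILE (Less (Var r_qi) (Add (Var r_qn) (Var r_cur))) peel_body) s
      ((3 * m + 2) * (6 + run_time peel_body))
      (\<lambda>s. peel_state_inv s \<and> \<not> vars s r_qi < vars s r_qn + vars s r_cur)"
    if "peel_state_inv s \<and> peel_measure s \<le> 3 * m + 1" for s
    using runs_peeling that by auto
  have "runs B solve (input_state n es ts)
    (run_time init_targets + ((m + 2) * (4 + run_time mark_body) + (run_time init_link + ((m + 1) * (4 + run_time link_body) +
      (run_time init_sinks + ((m + 1) * (4 + run_time sink_body) + (run_time init_peel + ((3 * m + 2) * (6 + run_time peel_body) +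
      (run_time init_root + ((m + 1) * (4 + run_time root_body) +
        (run_time init_output + (m + 1) * (4 + run_time output_body))))))))))))
    (\<lambda>s. lists_set (output_list s) ?W)"
    unfolding solve_def
    by (rule runs_Seq[OF mark runs_Seq[OF runs_marking runs_Seq[OF link runs_Seq[OF linking
      runs_Seq[OF sinks runs_Seq[OF sinking runs_Seq[OF peel runs_Seq[OF peeling rt]]]]]]]]) simp_all
  then show ?thesis by (rule runs_weaken) (simp_all add: code_defs)
qed

text \<open>Pigeonhole: if targets were cut off, \<open>T\<close> has \<open>m + 1\<close> elements,
  while at most \<open>m\<close> vertices recur, so every play misses a target in
  \<open>T\<close>.\<close>

lemma winning_set_first_targets:
  "winning_set {..<n} (set es) (\<Union>t\<in>set ts. coBuchi {t}) =
    winning_set {..<n} (set es) (\<Union>t\<in>T. coBuchi {t})"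
proof
  have "T \<subseteq> set ts" unfolding T_def by (rule set_take_subset)
  then show "winning_set {..<n} (set es) (\<Union>t\<in>T. coBuchi {t}) \<subseteq>
      winning_set {..<n} (set es) (\<Union>t\<in>set ts. coBuchi {t})"
    by (auto simp: winning_set_def)
  have "\<exists>t\<in>T. t \<notin> limit \<omega>" if \<omega>: "\<omega> \<in> plays {..<n} (set es)" "t \<in> set ts" "t \<notin> limit \<omega>" for \<omega> t
  proof (cases "length ts \<le> m + 1")
    case True
    then show ?thesis using \<omega> by (auto simp: T_def K_def)
  next
    case False
    have "card (limit \<omega>) \<le> m"
      using card_limit_play_le(2)[OF \<omega>(1)] card_length[of es] by (simp add: m_def)
    also have "m < card T" using False by (simp add: card_T K_def)
    finally show ?thesis using card_mono[OF card_limit_play_le(1)[OF \<omega>(1)], of T] by fastforce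
  qed
  then show "winning_set {..<n} (set es) (\<Union>t\<in>set ts. coBuchi {t}) \<subseteq>
      winning_set {..<n} (set es) (\<Union>t\<in>T. coBuchi {t})"
    by (fastforce simp: winning_set_def coBuchi_def)
qed

end

text \<open>The word bound may grow with \<open>n\<close>, but the time depends on the number of
  edges alone. Equal sets \<open>T i\<close> appear once in \<open>ts\<close>, which leaves the
  union of the objectives unchanged.\<close>

theorem theorem10:
  shows "\<exists>(p :: com) (\<tau> :: nat \<Rightarrow> nat) (d :: nat).
    (\<lambda>m. real (\<tau> m)) \<in> O(\<lambda>m. real m) \<and>
    (\<forall>(n :: nat) (V :: nat set) (E :: (nat \<times> nat) set) (k :: nat) (T :: nat \<Rightarrow> nat set)
        (es :: (nat \<times> nat) list) (ts :: nat list).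
      V = {..<n} \<longrightarrow> digraph V E \<longrightarrow>
      (\<forall>i\<in>{1..k}. T i \<subseteq> V \<and> card (T i) = 1) \<longrightarrow>
      lists_set es E \<longrightarrow> lists_set (map (\<lambda>v. {v}) ts) (T ` {1..k}) \<longrightarrow>
      (\<exists>t s'. exec (d * (n + card E + 1)) p (input_state n es ts) t s' \<and>
        t \<le> \<tau> (card E) \<and>
        lists_set (output_list s') (winning_set V E (\<Union>i\<in>{1..k}. coBuchi (T i)))))"
proof (rule exI[of _ coBuchi_program], rule exI[of _ "\<lambda>m. 1000 * (m + 1) + 5"], rule exI[of _ 6],
    intro conjI allI impI)
  show "(\<lambda>m. real (1000 * (m + 1) + 5)) \<in> O(\<lambda>m. real m)"
  \<comment> \<open>For \<open>m \<ge> 1\<close>,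
    \<open>1000 * m + 1005 \<le> 2005 * m\<close>.\<close>
  proof (rule landau_o.bigI[of 2005])
    show "\<forall>\<^sub>F m in at_top. norm (real (1000 * (m + 1) + 5)) \<le> 2005 * norm (real m)"
      using eventually_ge_at_top[of "1 :: nat"] by eventually_elim simp
  qed simp
next
  fix n :: nat and V :: "nat set" and E :: "(nat \<times> nat) set" and k and T :: "nat \<Rightarrow> nat set"
    and es ts
  assume V: "V = {..<n}" and E: "digraph V E"
    and T: "\<forall>i\<in>{1..k}. T i \<subseteq> V \<and> card (T i) = 1"
    and es: "lists_set es E" and ts: "lists_set (map (\<lambda>v. {v}) ts) (T ` {1..k})"
  let ?B = "6 * (n + card E + 1)" and ?s = "input_state n es ts"
  have E_eq: "set es = E" "length es = card E" using es by (auto simp: lists_set_def distinct_card)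
  have ts_eq: "(\<lambda>v. {v}) ` set ts = T ` {1..k}" "distinct ts"
    using ts by (auto simp: lists_set_def distinct_map)
  have ts_V: "set ts \<subseteq> V"
  proof
    fix v assume "v \<in> set ts"
    then have "{v} \<in> T ` {1..k}" using ts_eq(1) by blast
    then show "v \<in> V" using T by auto
  qed
  have "(\<Union>i\<in>{1..k}. coBuchi (T i)) = \<Union> (coBuchi ` (T ` {1..k}))" by simp
  also have "\<dots> = (\<Union>t\<in>set ts. coBuchi {t})" unfolding ts_eq(1)[symmetric] by simp
  finally have obj: "(\<Union>i\<in>{1..k}. coBuchi (T i)) = (\<Union>t\<in>set ts. coBuchi {t})" .
  have len: "vars ?s r_len = length ts" by (simp add: input_state_def)
  show "\<exists>t s'. exec ?B coBuchi_program ?s t s' \<and> t \<le> 1000 * (card E + 1) + 5 \<and>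
      lists_set (output_list s') (winning_set V E (\<Union>i\<in>{1..k}. coBuchi (T i)))"
  proof (cases "ts = []")
    case True
    \<comment> \<open>This branch takes 5 units: 4 for the conditional and its test, 1 for
      \<open>SKIP\<close>. Register 3 is still 0, so the output is empty.\<close>
    have "exec ?B coBuchi_program ?s (1 + ccost (Equal (Var r_len) (Const 0)) + 1) ?s"
      unfolding coBuchi_program_def using True len by (intro exec.IfTrue exec.Skip) auto
    moreover have "lists_set (output_list ?s) (winning_set V E (\<Union>i\<in>{1..k}. coBuchi (T i)))"
      unfolding obj using True
      by (simp add: lists_set_def output_list_def input_state_def winning_set_def)
    ultimately show ?thesis by fastforce
  next
    case False
    interpret coBuchi_input n es ts
      using E V E_eq ts_eq(2) ts_V False by unfold_locales (auto simp: digraph_def)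
    have B: "B = ?B" and m: "m = card E" by (simp_all add: B_def m_def E_eq)
    \<comment> \<open>\<open>coBuchi_input.T es ts\<close> is the truncated target set, as opposed
      to the given family \<open>T\<close>.\<close>
    obtain t s' where t: "exec B solve ?s t s'" "t \<le> 1000 * (m + 1)"
      "lists_set (output_list s') (winning_set {..<n} (set es) (\<Union>t\<in>coBuchi_input.T es ts. coBuchi {t}))"
      using runs_solve unfolding runs_def by blast
    have "exec ?B coBuchi_program ?s (1 + ccost (Equal (Var r_len) (Const 0)) + t) s'"
      unfolding coBuchi_program_def B[symmetric]
      using t(1) False len length_ts B_ge by (intro exec.IfFalse) auto
    moreover have "lists_set (output_list s') (winning_set V E (\<Union>i\<in>{1..k}. coBuchi (T i)))"
      using t(3) winning_set_first_targets unfolding obj V E_eq(1) by simp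
    moreover have "1 + ccost (Equal (Var r_len) (Const 0)) + t \<le> 1000 * (card E + 1) + 5"
      using t(2) m by simp
    ultimately show ?thesis by blast
  qed
qed

end
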